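(* Let $d\in\mathbb{N}$, let $R,S$ be finite subsets of $\mathbb{N}_0^d\setminus\{\mathbf 0\}$, let $(\phi_{\mathbf n})_{\mathbf n\in R},(\theta_{\mathbf n})_{\mathbf n\in S}\subset\mathbb{C}$, and let $(Z_{\mathbf t})_{\mathbf t\in\mathbb{Z}^d}$ be an i.i.d. complex-valued random field. A causal solution of the ARMA equation $$Y_{\mathbf t}-\sum_{\mathbf n\in R}\phi_{\mathbf n}Y_{\mathbf t-\mathbf n}=Z_{\mathbf t}+\sum_{\mathbf n\in S}\theta_{\mathbf n}Z_{\mathbf t-\mathbf n},\qquad \mathbf t\in\mathbb{Z}^d,$$ exists if one of the following conditions is fulfilled: (i) $\mathbb{E}\log_+^d|Z_{\mathbf 0}|<\infty$ and $\Phi(\mathbf z)\neq 0$ for all $\mathbf z\in\overline{\mathbb{D}}^d$; (ii) $\mathbb{E}|Z_{\mathbf 0}|^2<\infty$, $\mathbb{E}Z_{\mathbf 0}=0$ and $\Theta(\mathbf z)/\Phi(\mathbf z)\in H^2$. In both cases the quotient $\Theta/\Phi$ admits a power series expansion $$\frac{\Theta(\mathbf z)}{\Phi(\mathbf z)}=\sum_{\mathbf k\in\mathbb{N}_0^d}\psi_{\mathbf k}\mathbf z^{\mathbf k},\qquad \mathbf z\in\mathbb{D}^d,$$ and a causal solution is given by $$Y_{\mathbf t}=\sum_{\mathbf k\in\mathbb{N}_0^d}\psi_{\mathbf k}Z_{\mathbf t-\mathbf k},\qquad \mathbf t\in\mathbb{Z}^d.$$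
   Context: Notation: $\mathbf z^{\mathbf n}=z_1^{n_1}\cdots z_d^{n_d}$; $\Phi(\mathbf z)=1-\sum_{\mathbf n\in R}\phi_{\mathbf n}\mathbf z^{\mathbf n}$, $\Theta(\mathbf z)=1+\sum_{\mathbf n\in S}\theta_{\mathbf n}\mathbf z^{\mathbf n}$; $\mathbb{D}^d=\{\mathbf z\in\mathbb{C}^d:|z_i|<1,\ i=1,\dots,d\}$ and $\overline{\mathbb{D}}^d$ is its closure; $\log_+(z)=\max(\log z,0)$ for $z\ge0$ (with $\log_+(0)=0$), $\log_+^d(z)=(\log_+z)^d$. For $\mathbf s,\mathbf t\in\mathbb{Z}^d$, $\mathbf s\le\mathbf t$ means $s_i\le t_i$ for all $i$. A strictly stationary complex-valued random field $(Y_{\mathbf t})_{\mathbf t\in\mathbb{Z}^d}$ fulfilling the ARMA equation is called a causal solution if $Y_{\mathbf t}$ is measurable with respect to $\sigma(Z_{\mathbf s}:\mathbf s\le\mathbf t)$ for each $\mathbf t\in\mathbb{Z}^d$. $H^2$ is the Hardy space of all holomorphic $f:\mathbb{D}^d\to\mathbb{C}$ with $\sup_{0\le r<1}\frac{1}{(2\pi)^d}\int_{(-\pi,\pi]^d}|f(re^{-i\mathbf t})|^2\,d\lambda^d(\mathbf t)<\infty$, where $\lambda^d$ is Lebesgue measure and $e^{-i\mathbf t}=(e^{-it_1},\dots,e^{-it_d})$; equivalently $f(\mathbf z)=\sum_{\mathbf k\in\mathbb{N}_0^d}a_{\mathbf k}\mathbf z^{\mathbf k}$ on $\mathbb{D}^d$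 with $\sum_{\mathbf k}|a_{\mathbf k}|^2<\infty$. "$\Theta/\Phi\in H^2$" means that there is $f\in H^2$ with $\Phi f=\Theta$ on $\mathbb{D}^d$ (this $f$ is then unique and is denoted $\Theta/\Phi$). *)

theory Defs
  imports "HOL-Probability.Probability"
begin

section \<open>Functions on the polydisc\<close>

definition polydisc :: "(complex ^ 'd::finite) set" where
  "polydisc = {z. \<forall>i. cmod (z $ i) < 1}"

definition monomial :: "complex ^ 'd::finite \<Rightarrow> nat ^ 'd \<Rightarrow> complex" where
  "monomial z n = (\<Prod>i\<in>UNIV. (z $ i) ^ (n $ i))"

definition ar_poly :: "(nat ^ 'd::finite) set \<Rightarrow> (nat ^ 'd \<Rightarrow> complex) \<Rightarrow> complex ^ 'd \<Rightarrow> complex" where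
  "ar_poly R \<phi> z = 1 - (\<Sum>n\<in>R. \<phi> n * monomial z n)"

definition ma_poly :: "(nat ^ 'd::finite) set \<Rightarrow> (nat ^ 'd \<Rightarrow> complex) \<Rightarrow> complex ^ 'd \<Rightarrow> complex" where
  "ma_poly S \<theta> z = 1 + (\<Sum>n\<in>S. \<theta> n * monomial z n)"

text \<open>Holomorphy in several variables: at each point the Frechet derivative exists and is
  complex linear. Meant for open \<open>U\<close>.\<close>

definition holomorphic_several :: "(complex ^ 'd::finite \<Rightarrow> complex) \<Rightarrow> (complex ^ 'd) set \<Rightarrow> bool" where
  "holomorphic_several f U \<longleftrightarrow>
     (\<forall>z\<in>U. \<exists>c :: complex ^ 'd. (f has_derivative (\<lambda>h. \<Sum>i\<in>UNIV. c $ i * h $ i)) (at z))"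

text \<open>Only the values of a member on \<open>polydisc\<close> matter; outside it is arbitrary.\<close>

definition hardy2 :: "(complex ^ 'd::finite \<Rightarrow> complex) set" where
  "hardy2 = {f. holomorphic_several f polydisc \<and>
     (SUP r\<in>{0..<1::real}. ennreal (1 / (2 * pi) ^ CARD('d)) *
        (\<integral>\<^sup>+ t \<in> {t :: real ^ 'd. \<forall>i. - pi < t $ i \<and> t $ i \<le> pi}.
           ennreal ((cmod (f (\<chi> i. of_real r * exp (- \<i> * of_real (t $ i)))))\<^sup>2) \<partial>lborel)) < \<infinity>}"

section \<open>Random fields\<close>

definition log_plus :: "real \<Rightarrow> real" where
  "log_plus x = (if x = 0 then 0 else max (ln x) 0)"

definition lag :: "int ^ 'd::finite \<Rightarrow> nat ^ 'd \<Rightarrow> int ^ 'd" where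
  "lag t n = t - (\<chi> i. int (n $ i))"

definition iid_field :: "'w measure \<Rightarrow> (int ^ 'd::finite \<Rightarrow> 'w \<Rightarrow> complex) \<Rightarrow> bool" where
  "iid_field M Z \<longleftrightarrow>
     prob_space.indep_vars M (\<lambda>_. borel) Z UNIV \<and>
     (\<forall>s t. distr M borel (Z s) = distr M borel (Z t))"

text \<open>Strict stationarity through finite-dimensional distributions.\<close>

definition strictly_stationary :: "'w measure \<Rightarrow> (int ^ 'd::finite \<Rightarrow> 'w \<Rightarrow> complex) \<Rightarrow> bool" where
  "strictly_stationary M Y \<longleftrightarrow>
     (\<forall>t. Y t \<in> borel_measurable M) \<and>
     (\<forall>J h. finite J \<longrightarrow>
        distr M (\<Pi>\<^sub>M t\<in>J. borel) (\<lambda>\<omega>. \<lambda>t\<in>J. Y (t + h) \<omega>) =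
        distr M (\<Pi>\<^sub>M t\<in>J. borel) (\<lambda>\<omega>. \<lambda>t\<in>J. Y t \<omega>))"

text \<open>As usual for equations between random variables, the ARMA equation is required
  almost surely.\<close>

definition arma_equation ::
  "'w measure \<Rightarrow> (nat ^ 'd::finite) set \<Rightarrow> (nat ^ 'd \<Rightarrow> complex) \<Rightarrow>
   (nat ^ 'd) set \<Rightarrow> (nat ^ 'd \<Rightarrow> complex) \<Rightarrow>
   (int ^ 'd \<Rightarrow> 'w \<Rightarrow> complex) \<Rightarrow> (int ^ 'd \<Rightarrow> 'w \<Rightarrow> complex) \<Rightarrow> bool" where
  "arma_equation M R \<phi> S \<theta> Z Y \<longleftrightarrow>
     (\<forall>t. AE \<omega> in M. Y t \<omega> - (\<Sum>n\<in>R. \<phi> n * Y (lag t n) \<omega>) =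
                     Z t \<omega> + (\<Sum>n\<in>S. \<theta> n * Z (lag t n) \<omega>))"

text \<open>The order on \<open>int ^ 'd\<close> is the componentwise one.\<close>

definition past_sigma :: "'w measure \<Rightarrow> (int ^ 'd::finite \<Rightarrow> 'w \<Rightarrow> complex) \<Rightarrow> int ^ 'd \<Rightarrow> 'w measure" where
  "past_sigma M Z t = sigma (space M) {Z s -` A \<inter> space M | s A. s \<le> t \<and> A \<in> sets borel}"

definition causal_solution ::
  "'w measure \<Rightarrow> (nat ^ 'd::finite) set \<Rightarrow> (nat ^ 'd \<Rightarrow> complex) \<Rightarrow>
   (nat ^ 'd) set \<Rightarrow> (nat ^ 'd \<Rightarrow> complex) \<Rightarrow>
   (int ^ 'd \<Rightarrow> 'w \<Rightarrow> complex) \<Rightarrow> (int ^ 'd \<Rightarrow> 'w \<Rightarrow> complex) \<Rightarrow> bool" where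
  "causal_solution M R \<phi> S \<theta> Z Y \<longleftrightarrow>
     strictly_stationary M Y \<and> arma_equation M R \<phi> S \<theta> Z Y \<and>
     (\<forall>t. Y t \<in> borel_measurable (past_sigma M Z t))"

text \<open>\<open>Y t\<close> is the sum of \<open>\<psi> k * Z (t - k)\<close> over all multi-indices: almost surely absolutely
  (unordered summation in the complex numbers is absolute), respectively as the unordered limit
  in the mean square of the finite partial sums. The second mode is needed for square-summable
  \<open>\<psi>\<close> and centred square-integrable \<open>Z\<close>, where almost sure absolute convergence can fail.
  Either mode determines \<open>Y t\<close> up to null sets.\<close>

definition linear_field_as ::
  "'w measure \<Rightarrow> (nat ^ 'd::finite \<Rightarrow> complex) \<Rightarrow>
   (int ^ 'd \<Rightarrow> 'w \<Rightarrow> complex) \<Rightarrow> (int ^ 'd \<Rightarrow> 'w \<Rightarrow> complex) \<Rightarrow> bool" where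
  "linear_field_as M \<psi> Z Y \<longleftrightarrow>
     (\<forall>t. AE \<omega> in M. ((\<lambda>k. \<psi> k * Z (lag t k) \<omega>) has_sum Y t \<omega>) UNIV)"

definition linear_field_L2 ::
  "'w measure \<Rightarrow> (nat ^ 'd::finite \<Rightarrow> complex) \<Rightarrow>
   (int ^ 'd \<Rightarrow> 'w \<Rightarrow> complex) \<Rightarrow> (int ^ 'd \<Rightarrow> 'w \<Rightarrow> complex) \<Rightarrow> bool" where
  "linear_field_L2 M \<psi> Z Y \<longleftrightarrow>
     (\<forall>t. ((\<lambda>F. \<integral>\<^sup>+ \<omega>. ennreal ((cmod (Y t \<omega> - (\<Sum>k\<in>F. \<psi> k * Z (lag t k) \<omega>)))\<^sup>2) \<partial>M)
            \<longlongrightarrow> 0) (finite_subsets_at_top UNIV))"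

end

theory Submission
  imports Defs "HOL-Complex_Analysis.Complex_Analysis"
begin

text \<open>
  Let \<open>\<psi>\<close> be the coefficients of \<open>\<Theta> / \<Phi>\<close> as a formal power series. For fixed \<open>w\<close> the function
  \<open>\<lambda> \<mapsto> (\<Theta> / \<Phi>)(\<lambda> w)\<close> of one complex variable has as its \<open>m\<close>-th Taylor coefficient the homogeneous
  part \<open>\<Sum>|k| = m. \<psi> k w^k\<close>, which Cauchy's inequality bounds on a polydisc of radius \<open>\<rho>\<close>; Parseval's
  identity on the torus turns this into \<open>|\<psi> k| \<le> C \<rho>^(-|k|)\<close>. In case (i) compactness allows
  \<open>\<rho> > 1\<close>. In case (ii) every \<open>\<rho> < 1\<close> is allowed, so the series represents \<open>f\<close>, and Parseval
  bounds \<open>\<Sum>|\<psi> k|^2\<close> by the Hardy norm.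

  In case (i), the number of \<open>k\<close> with \<open>a |k| < log\<^sub>+|Z|\<close> is of order \<open>(log\<^sub>+|Z|)^d\<close>, so by the moment
  condition (Borel-Cantelli) almost surely all but finitely many \<open>Z (t - k)\<close> are bounded by
  \<open>exp (a |k|)\<close>, and the series for \<open>Y t\<close> converges absolutely. In case (ii) the \<open>Z s\<close> are orthogonal
  in mean square. Finite partial sums with geometrically small tails, the same for every \<open>t\<close>,
  converge almost surely and in mean square. In both cases \<open>Y\<close> is a pointwise limit along one sequence
  of finite index sets, hence one fixed measurable function of the shifted field, which gives
  causality and stationarity.
\<close>

no_notation fps_nth (infixl "$" 75)

section \<open>Multi-indices and monomials\<close>

definition mdeg :: "nat ^ 'd::finite \<Rightarrow> nat" where
  "mdeg k = (\<Sum>i\<in>UNIV. k $ i)"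

lemma mdeg_0 [simp]: "mdeg 0 = 0"
  by (simp add: mdeg_def)

lemma mdeg_eq_0_iff [simp]: "mdeg k = 0 \<longleftrightarrow> k = 0"
  by (simp add: mdeg_def vec_eq_iff)

lemma mdeg_add: "mdeg (k + n) = mdeg k + mdeg n"
  by (simp add: mdeg_def sum.distrib)

lemma le_mdeg: "k $ i \<le> mdeg k"
  unfolding mdeg_def by (rule member_le_sum) auto

lemma diff_add_vec:
  fixes k n :: "nat ^ 'd::finite"
  shows "n \<le> k \<Longrightarrow> (k - n) + n = k"
  by (auto simp: less_eq_vec_def vec_eq_iff)

lemma mdeg_diff: "n \<le> k \<Longrightarrow> mdeg (k - n) + mdeg n = mdeg k"
  by (metis diff_add_vec mdeg_add)

text \<open>Identifies a box of multi-indices with a finite function space, where finiteness,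
  counting and the product formula for sums are available.\<close>

lemma box_image: "{k :: nat ^ 'd::finite. \<forall>i. k $ i \<le> N} = vec_lambda ` (UNIV \<rightarrow>\<^sub>E {..N})"
proof (intro equalityI subsetI)
  fix k :: "nat ^ 'd" assume "k \<in> {k. \<forall>i. k $ i \<le> N}"
  then have "vec_nth k \<in> (UNIV \<rightarrow>\<^sub>E {..N})" "k = vec_lambda (vec_nth k)" by auto
  then show "k \<in> vec_lambda ` (UNIV \<rightarrow>\<^sub>E {..N})" by blast
qed auto

lemma inj_vec_lambda: "inj_on vec_lambda A"
  by (metis inj_onI vec_lambda_inverse UNIV_I)

lemma finite_box: "finite {k :: nat ^ 'd::finite. \<forall>i. k $ i \<le> N}"
  unfolding box_image by (intro finite_imageI finite_PiE) auto

lemma finite_mdeg_le: "finite {k :: nat ^ 'd::finite. mdeg k \<le> m}"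
  by (rule finite_subset[OF _ finite_box[of m]]) (use le_mdeg order_trans in blast)

lemma finite_mdeg_eq: "finite {k :: nat ^ 'd::finite. mdeg k = m}"
  by (rule finite_subset[OF _ finite_mdeg_le[of m]]) auto

text \<open>The simplex is counted through the enclosing box. The order \<open>m ^ CARD('d)\<close>
  is what links the moment condition to the dimension.\<close>

lemma card_mdeg_le: "card {k :: nat ^ 'd::finite. mdeg k \<le> m} \<le> (m + 1) ^ CARD('d)"
proof -
  have "card {k :: nat ^ 'd. mdeg k \<le> m} \<le> card {k :: nat ^ 'd. \<forall>i. k $ i \<le> m}"
    by (intro card_mono finite_box) (use le_mdeg order_trans in blast)
  also have "\<dots> = card ((UNIV :: 'd set) \<rightarrow>\<^sub>E {..m})"
    unfolding box_image by (intro card_image inj_vec_lambda)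
  also have "\<dots> = (m + 1) ^ CARD('d)" by (simp add: card_PiE)
  finally show ?thesis .
qed

text \<open>Any finite partial sum is dominated by the sum over a box, which factors into one
  geometric sum per coordinate, each at most \<open>1 / (1 - q)\<close>.\<close>

lemma summable_on_power_mdeg:
  fixes q :: real
  assumes "0 \<le> q" "q < 1"
  shows "(\<lambda>k :: nat ^ 'd::finite. q ^ mdeg k) summable_on UNIV"
proof (rule nonneg_bdd_above_summable_on)
  show "0 \<le> q ^ mdeg k" for k :: "nat ^ 'd" using assms by simp
  show "bdd_above (sum (\<lambda>k :: nat ^ 'd. q ^ mdeg k) ` {F. F \<subseteq> UNIV \<and> finite F})"
  proof (rule bdd_aboveI2)
    fix F :: "(nat ^ 'd) set" assume "F \<in> {F. F \<subseteq> UNIV \<and> finite F}"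
    then have F: "finite F" by simp
    define N where "N = Max (insert 0 (mdeg ` F))"
    have N: "mdeg k \<le> N" if "k \<in> F" for k unfolding N_def using F that by (intro Max_ge) auto
    have "(\<Sum>k\<in>F. q ^ mdeg k) \<le> (\<Sum>k\<in>{k :: nat ^ 'd. \<forall>i. k $ i \<le> N}. q ^ mdeg k)"
      by (rule Groups_Big.sum_mono2[OF finite_box]) (use N le_mdeg order_trans assms in \<open>blast, auto\<close>)
    also have "\<dots> = (\<Sum>g\<in>(UNIV :: 'd set) \<rightarrow>\<^sub>E {..N}. \<Prod>i\<in>UNIV. q ^ g i)"
      unfolding box_image by (subst sum.reindex) (auto simp: inj_vec_lambda mdeg_def power_sum)
    also have "\<dots> = (\<Prod>i\<in>(UNIV :: 'd set). \<Sum>j\<in>{..N}. q ^ j)"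
      by (rule prod_sum_PiE[symmetric]) auto
    also have "\<dots> \<le> (\<Prod>i\<in>(UNIV :: 'd set). 1 / (1 - q))"
    proof (rule prod_mono, safe)
      show "(\<Sum>j\<in>{..N}. q ^ j) \<le> 1 / (1 - q)"
        using sum_le_suminf[of "\<lambda>j. q ^ j" "{..N}"] assms by (simp add: suminf_geometric)
    qed (use assms in \<open>auto intro: sum_nonneg\<close>)
    finally show "(\<Sum>k\<in>F. q ^ mdeg k) \<le> (1 / (1 - q)) ^ CARD('d)" by simp
  qed
qed

lemma monomial_add: "monomial z (k + n) = monomial z k * monomial z n"
  by (simp add: monomial_def power_add prod.distrib)

lemma norm_monomial_le:
  assumes "\<And>i. cmod (z $ i) \<le> r"
  shows "cmod (monomial z k) \<le> r ^ mdeg k"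
  unfolding monomial_def mdeg_def prod_norm[symmetric] norm_power power_sum
  by (intro prod_mono conjI power_mono assms) auto

lemma continuous_on_monomial [continuous_intros]: "continuous_on A (\<lambda>z. monomial z k)"
  unfolding monomial_def by (intro continuous_intros)

section \<open>Formal quotient and its one-variable slices\<close>

text \<open>The test \<open>n \<noteq> 0\<close> only serves termination; it is vacuous when \<open>0 \<notin> R\<close>.\<close>

function arma_coeff :: "(nat ^ 'd::finite) set \<Rightarrow> (nat ^ 'd \<Rightarrow> complex) \<Rightarrow>
    (nat ^ 'd) set \<Rightarrow> (nat ^ 'd \<Rightarrow> complex) \<Rightarrow> nat ^ 'd \<Rightarrow> complex" where
  "arma_coeff R \<phi> S \<theta> k = (if k = 0 then 1 else 0) + (if k \<in> S then \<theta> k else 0) +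
     (\<Sum>n\<in>R. if n \<noteq> 0 \<and> n \<le> k then \<phi> n * arma_coeff R \<phi> S \<theta> (k - n) else 0)"
  by auto
termination
proof (relation "inv_image less_than (\<lambda>(R, \<phi>, S, \<theta>, k). mdeg k)")
  fix n k :: "nat ^ 'd::finite" assume "n \<noteq> 0 \<and> n \<le> k"
  then have "mdeg (k - n) + mdeg n = mdeg k" "mdeg n > 0"
    by (auto simp: mdeg_diff zero_less_iff_neq_zero)
  then have "mdeg (k - n) < mdeg k" by linarith
  then show "((R, \<phi>, S, \<theta>, k - n), R, \<phi>, S, \<theta>, k) \<in> inv_image less_than (\<lambda>(R, \<phi>, S, \<theta>, k). mdeg k)" for R \<phi> S \<theta>
    by simp
qed auto

declare arma_coeff.simps [simp del]

text \<open>This is the coefficient of \<open>monomial z k\<close> in the formal identity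
  \<open>\<Phi> * \<psi> = \<Theta>\<close>; \<open>0 \<notin> R\<close> makes the termination test
  disappear.\<close>

lemma arma_coeff_rec:
  assumes "0 \<notin> R"
  shows "arma_coeff R \<phi> S \<theta> k - (\<Sum>n\<in>R. if n \<le> k then \<phi> n * arma_coeff R \<phi> S \<theta> (k - n) else 0)
     = (if k = 0 then 1 else 0) + (if k \<in> S then \<theta> k else 0)"
proof -
  have "(\<Sum>n\<in>R. if n \<noteq> 0 \<and> n \<le> k then \<phi> n * arma_coeff R \<phi> S \<theta> (k - n) else 0)
      = (\<Sum>n\<in>R. if n \<le> k then \<phi> n * arma_coeff R \<phi> S \<theta> (k - n) else 0)"
    using assms by (intro sum.cong) auto
  then show ?thesis by (subst arma_coeff.simps) simp
qed

text \<open>For the power series with coefficients \<open>\<psi>\<close> this is the coefficient of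
  \<open>x ^ m\<close> after restriction to the complex line \<open>x \<mapsto> x w\<close>.\<close>

definition hom_part :: "(nat ^ 'd::finite \<Rightarrow> complex) \<Rightarrow> complex ^ 'd \<Rightarrow> nat \<Rightarrow> complex" where
  "hom_part \<psi> w m = (\<Sum>k | mdeg k = m. \<psi> k * monomial w k)"

text \<open>Multiplication by a monomial of exponent \<open>n\<close> moves each homogeneous part up
  by \<open>mdeg n\<close> degrees; the substitution is \<open>k = j + n\<close>.\<close>

lemma hom_part_shift:
  assumes "mdeg n \<le> m"
  shows "(\<Sum>k | mdeg k = m. (if n \<le> k then \<phi> n * \<psi> (k - n) else 0) * monomial w k)
    = \<phi> n * monomial w n * hom_part \<psi> w (m - mdeg n)"
proof -
  have "(\<Sum>k | mdeg k = m. (if n \<le> k then \<phi> n * \<psi> (k - n) else 0) * monomial w k)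
      = (\<Sum>k | mdeg k = m \<and> n \<le> k. \<phi> n * \<psi> (k - n) * monomial w k)"
    by (rule sum.mono_neutral_cong_right) (auto simp: finite_mdeg_eq)
  also have "\<dots> = (\<Sum>j | mdeg j = m - mdeg n. \<phi> n * monomial w n * (\<psi> j * monomial w j))"
  proof (rule sum.reindex_bij_witness[of _ "\<lambda>j. j + n" "\<lambda>k. k - n"])
    fix k assume "k \<in> {k. mdeg k = m \<and> n \<le> k}"
    then have "k - n + n = k" "mdeg (k - n) + mdeg n = m" by (auto simp: diff_add_vec mdeg_diff)
    moreover from this have h: "monomial w k = monomial w (k - n) * monomial w n"
      using monomial_add by metis
    ultimately show "k - n + n = k" "k - n \<in> {j. mdeg j = m - mdeg n}"
      "\<phi> n * monomial w n * (\<psi> (k - n) * monomial w (k - n)) = \<phi> n * \<psi> (k - n) * monomial w k"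
      by (auto simp: h mult_ac)
  next
    fix j :: "nat ^ 'a" assume "j \<in> {j. mdeg j = m - mdeg n}"
    then show "j + n - n = j" "j + n \<in> {k. mdeg k = m \<and> n \<le> k}"
      using assms by (auto simp: mdeg_add less_eq_vec_def)
  qed
  finally show ?thesis by (simp add: hom_part_def sum_distrib_left)
qed

text \<open>Summing \<open>arma_coeff_rec\<close> against \<open>monomial w k\<close> over one
  degree turns it into the coefficient identity of the one-variable series that
  \<open>\<Phi>\<close>, \<open>\<psi>\<close> and \<open>\<Theta>\<close> become on the line
  through \<open>w\<close>.\<close>

lemma hom_part_rec:
  fixes \<phi> \<theta> :: "nat ^ 'd::finite \<Rightarrow> complex"
  assumes R: "finite R" "0 \<notin> R" and S: "finite S"
  defines "\<psi> \<equiv> arma_coeff R \<phi> S \<theta>"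
  shows "hom_part \<psi> w m - (\<Sum>n\<in>R. if mdeg n \<le> m then \<phi> n * monomial w n * hom_part \<psi> w (m - mdeg n) else 0)
    = (if m = 0 then 1 else 0) + (\<Sum>n\<in>S. if mdeg n = m then \<theta> n * monomial w n else 0)"
proof -
  let ?s = "\<lambda>n k. if n \<le> k then \<phi> n * \<psi> (k - n) else 0"
  have *: "(if mdeg n \<le> m then \<phi> n * monomial w n * hom_part \<psi> w (m - mdeg n) else 0)
     = (\<Sum>k | mdeg k = m. ?s n k * monomial w k)" for n
  proof (cases "mdeg n \<le> m")
    case False
    then have "\<not> n \<le> k" if "mdeg k = m" for k
      using mdeg_diff[of n k] that by auto
    then show ?thesis using False by (simp add: sum.neutral)
  qed (simp add: hom_part_shift)
  have "hom_part \<psi> w m - (\<Sum>n\<in>R. if mdeg n \<le> m then \<phi> n * monomial w n * hom_part \<psi> w (m - mdeg n) else 0)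
    = (\<Sum>k | mdeg k = m. (\<psi> k - (\<Sum>n\<in>R. ?s n k)) * monomial w k)"
    unfolding * by (subst sum.swap) (simp add: hom_part_def left_diff_distrib sum_subtractf sum_distrib_right)
  also have "\<dots> = (\<Sum>k | mdeg k = m. ((if k = 0 then 1 else 0) + (if k \<in> S then \<theta> k else 0)) * monomial w k)"
    unfolding \<psi>_def by (subst arma_coeff_rec) (use R in auto)
  also have "\<dots> = (\<Sum>k :: nat ^ 'd | mdeg k = m. if k = 0 then 1 else 0) + (\<Sum>k | mdeg k = m. if k \<in> S then \<theta> k * monomial w k else 0)"
    unfolding sum.distrib[symmetric] by (intro sum.cong) (auto simp: monomial_def distrib_right)
  also have "(\<Sum>k :: nat ^ 'd | mdeg k = m. if k = 0 then 1 else (0 :: complex)) = (if m = 0 then 1 else 0)"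
    by (subst sum.delta) (auto simp: finite_mdeg_eq)
  also have "(\<Sum>k | mdeg k = m. if k \<in> S then \<theta> k * monomial w k else 0) = (\<Sum>n\<in>S. if mdeg n = m then \<theta> n * monomial w n else 0)"
    by (subst sum.inter_filter[symmetric, OF S], subst sum.inter_filter[symmetric, OF finite_mdeg_eq])
      (intro sum.cong, auto)
  finally show ?thesis .
qed

section \<open>Parseval on the torus\<close>

text \<open>Pythagoras: the squared modulus expands into a double sum of which only the diagonal
  survives integration. The measure is general because the result serves both the characters on the
  torus and the noise variables.\<close>

lemma integral_norm_sum_orthogonal:
  fixes e :: "'k \<Rightarrow> 'a \<Rightarrow> complex"
  assumes F: "finite F"
    and int: "\<And>k l. k \<in> F \<Longrightarrow> l \<in> F \<Longrightarrow> integrable M (\<lambda>x. e k x * cnj (e l x))"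
    and orth: "\<And>k l. k \<in> F \<Longrightarrow> l \<in> F \<Longrightarrow>
      (LINT x|M. e k x * cnj (e l x)) = (if k = l then complex_of_real s else 0)"
  shows "(\<integral>\<^sup>+x. ennreal ((cmod (\<Sum>k\<in>F. c k * e k x))\<^sup>2) \<partial>M) = ennreal (s * (\<Sum>k\<in>F. (cmod (c k))\<^sup>2))"
proof -
  let ?f = "\<lambda>x. (cmod (\<Sum>k\<in>F. c k * e k x))\<^sup>2"
  have eq: "complex_of_real (?f x) = (\<Sum>k\<in>F. \<Sum>l\<in>F. c k * cnj (c l) * (e k x * cnj (e l x)))" for x
    unfolding complex_norm_square cnj_sum sum_product by (simp add: mult_ac)
  have i: "integrable M (\<lambda>x. complex_of_real (?f x))"
    unfolding eq by (intro Bochner_Integration.integrable_sum integrable_mult_right int)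
  then have i': "integrable M ?f" by (simp only: complex_of_real_integrable_eq)
  have "complex_of_real (LINT x|M. ?f x) = (LINT x|M. complex_of_real (?f x))"
    by (rule integral_complex_of_real[symmetric])
  also have "\<dots> = (\<Sum>k\<in>F. \<Sum>l\<in>F. c k * cnj (c l) * (if k = l then complex_of_real s else 0))"
    unfolding eq by (simp add: Bochner_Integration.integral_sum Bochner_Integration.integrable_sum int orth)
  also have "\<dots> = (\<Sum>k\<in>F. c k * cnj (c k) * s)"
    using F by (intro sum.cong refl) (simp add: if_distrib cong: if_cong)
  also have "\<dots> = complex_of_real (s * (\<Sum>k\<in>F. (cmod (c k))\<^sup>2))"
    by (simp add: complex_norm_square[symmetric] sum_distrib_left mult_ac)
  finally have "(LINT x|M. ?f x) = s * (\<Sum>k\<in>F. (cmod (c k))\<^sup>2)" by (simp only: of_real_eq_iff)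
  with i' show ?thesis by (subst nn_integral_eq_integral) auto
qed

text \<open>Fubini for product integrands. \<open>lborel\<close> on vectors is the image of a
  product measure indexed by \<open>Basis\<close>, so the bijection \<open>a\<close> from
  coordinates to basis vectors is used to turn the product over coordinates into one over
  \<open>Basis\<close>.\<close>

lemma lborel_integral_prod_vec:
  fixes g :: "'d::finite \<Rightarrow> real \<Rightarrow> complex"
  assumes g: "\<And>i. integrable lborel (g i)"
  shows "integrable (lborel :: (real ^ 'd) measure) (\<lambda>t. \<Prod>i\<in>UNIV. g i (t $ i))"
    and "(\<integral>t. (\<Prod>i\<in>UNIV. g i (t $ i)) \<partial>(lborel :: (real ^ 'd) measure)) = (\<Prod>i\<in>UNIV. (LINT x|lborel. g i x))"
proof -
  interpret product_sigma_finite "\<lambda>_ :: real ^ 'd. lborel :: real measure" ..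
  define a :: "'d \<Rightarrow> real ^ 'd" where "a i = axis i 1" for i
  have inj: "inj a" by (auto simp: inj_def a_def axis_eq_axis)
  have B: "Basis = a ` UNIV" by (auto simp: Basis_vec_def a_def)
  define G where "G b = g (inv a b)" for b
  have Ga: "G (a i) = g i" for i by (simp add: G_def inj)
  have G: "integrable lborel (G b)" for b unfolding G_def by (rule g)
  have [measurable]: "g i \<in> borel_measurable borel" for i using borel_measurable_integrable[OF g[of i]] by simp
  have eq: "(\<Prod>i\<in>UNIV. g i (t $ i)) = (\<Prod>b\<in>Basis. G b (t \<bullet> b))" for t
    unfolding B by (subst prod.reindex[OF inj]) (simp add: Ga, simp add: a_def inner_axis)
  have eq': "(\<Prod>i\<in>UNIV. g i ((\<Sum>b\<in>Basis. f b *\<^sub>R b) $ i)) = (\<Prod>b\<in>Basis. G b (f b))" for f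
    unfolding eq by (intro prod.cong refl) simp
  show "integrable (lborel :: (real ^ 'd) measure) (\<lambda>t. \<Prod>i\<in>UNIV. g i (t $ i))"
    by (subst lborel_eq, subst integrable_distr_eq) (measurable, simp only: eq', intro product_integrable_prod G finite_Basis)
  have "(\<integral>t. (\<Prod>i\<in>UNIV. g i (t $ i)) \<partial>(lborel :: (real ^ 'd) measure))
      = (\<integral>f. (\<Prod>b\<in>Basis. G b (f b)) \<partial>(\<Pi>\<^sub>M b\<in>Basis. lborel))"
    by (subst lborel_eq, subst integral_distr) (measurable, simp only: eq')
  also have "\<dots> = (\<Prod>b\<in>Basis. (LINT x|lborel. G b x))"
    by (intro product_integral_prod G) auto
  also have "\<dots> = (\<Prod>i\<in>UNIV. (LINT x|lborel. g i x))"
    unfolding B by (subst prod.reindex[OF inj]) (simp add: Ga)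
  finally show "(\<integral>t. (\<Prod>i\<in>UNIV. g i (t $ i)) \<partial>(lborel :: (real ^ 'd) measure)) = (\<Prod>i\<in>UNIV. (LINT x|lborel. g i x))" .
qed

text \<open>For \<open>m \<noteq> 0\<close> the antiderivative takes equal values at both endpoints.
  The fundamental theorem is applied on the closed interval; the half-open one, which the Hardy norm
  uses, differs from it by a null set.\<close>

lemma integral_circle_character:
  fixes m :: int
  shows "integrable lborel (\<lambda>x. indicator {-pi<..pi} x *\<^sub>R exp (\<i> * of_int m * of_real x))" (is ?A)
    and "(LINT x|lborel. indicator {-pi<..pi} x *\<^sub>R exp (\<i> * of_int m * of_real x)) = (if m = 0 then 2 * pi else 0)" (is ?B)
proof -
  define F where "F x = (if m = 0 then complex_of_real x else exp (\<i> * of_int m * of_real x) / (\<i> * of_int m))" for x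
  let ?f = "\<lambda>x :: real. exp (\<i> * of_int m * of_real x)"
  have "has_bochner_integral lborel (\<lambda>x. indicator {-pi..pi} x *\<^sub>R ?f x) (F pi - F (-pi))"
  proof (rule has_bochner_integral_FTC_Icc)
    show "(F has_vector_derivative ?f x) (at x within {-pi..pi})" for x
      unfolding F_def
      by (cases "m = 0") (auto intro!: derivative_eq_intros has_vector_derivative_real_field)
    show "continuous_on {-pi..pi} ?f" by (intro continuous_intros)
  qed simp
  moreover have "F pi - F (-pi) = (if m = 0 then 2 * pi else 0)"
  proof -
    have "exp (\<i> * of_int m * of_real pi) = exp (\<i> * of_int m * of_real (-pi))"
      by (subst exp_eq) (auto intro!: exI[of _ m] simp: algebra_simps)
    then show ?thesis by (auto simp: F_def)
  qed
  ultimately have *: "has_bochner_integral lborel (\<lambda>x. indicator {-pi..pi} x *\<^sub>R ?f x) (if m = 0 then 2 * pi else 0)"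
    by simp
  have "has_bochner_integral lborel (\<lambda>x. indicator {-pi<..pi} x *\<^sub>R ?f x) (if m = 0 then 2 * pi else 0)"
  proof (rule has_bochner_integral_cong_AE[THEN iffD1, OF _ _ _ *])
    show "AE x in lborel. indicator {-pi..pi} x *\<^sub>R ?f x = indicator {-pi<..pi} x *\<^sub>R ?f x"
      using AE_lborel_singleton[of "-pi"] by eventually_elim (auto simp: indicator_def)
  qed (auto)
  then show ?A ?B by (auto simp: has_bochner_integral_iff)
qed

section \<open>Characters on the torus in several dimensions\<close>

definition torus_box :: "(real ^ 'd::finite) set" where
  "torus_box = {t. \<forall>i. - pi < t $ i \<and> t $ i \<le> pi}"

text \<open>The sign in the exponent agrees with the one in \<open>hardy2\<close>, so that the
  integrals there take this form on unfolding.\<close>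

definition torus_point :: "real ^ 'd::finite \<Rightarrow> complex ^ 'd" where
  "torus_point t = (\<chi> i. exp (- \<i> * of_real (t $ i)))"

lemma norm_torus_point [simp]: "cmod (torus_point t $ i) = 1"
  by (simp add: torus_point_def)

lemma continuous_on_torus_point [continuous_intros]: "continuous_on A torus_point"
  unfolding torus_point_def by (intro continuous_intros)

lemma torus_box_measurable [measurable]: "torus_box \<in> sets borel"
  unfolding torus_box_def by measurable

text \<open>The integrand factors into one-variable characters of frequency
  \<open>l $ i - k $ i\<close>; a single coordinate in which \<open>k\<close> and \<open>l\<close>
  differ annihilates the product of integrals.\<close>

lemma torus_orthogonal:
  fixes k l :: "nat ^ 'd::finite"
  defines "e \<equiv> \<lambda>(k :: nat ^ 'd) t. monomial (torus_point t) k"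
  shows "integrable (restrict_space lborel torus_box) (\<lambda>t. e k t * cnj (e l t))"
    and "(LINT t|restrict_space lborel torus_box. e k t * cnj (e l t)) = (if k = l then of_real ((2 * pi) ^ CARD('d)) else 0)"
proof -
  define m where "m i = int (l $ i) - int (k $ i)" for i
  let ?g = "\<lambda>i x. indicator {-pi<..pi} x *\<^sub>R exp (\<i> * of_int (m i) * of_real x)"
  have c: "torus_point t $ i * cnj (torus_point t $ i) = 1" for t and i :: 'd
    by (simp add: complex_norm_square[symmetric])
  have g: "(exp (- (\<i> * of_real x)) ^ (k $ i)) * cnj (exp (- (\<i> * of_real x)) ^ (l $ i)) = exp (\<i> * of_int (m i) * of_real x)" for i x
    by (simp add: exp_of_nat_mult[symmetric] exp_cnj exp_add[symmetric] m_def algebra_simps)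
  have eq: "indicator torus_box t *\<^sub>R (e k t * cnj (e l t)) = (\<Prod>i\<in>UNIV. ?g i (t $ i))" for t :: "real ^ 'd"
  proof (cases "t \<in> torus_box")
    case True
    then have "(\<Prod>i\<in>UNIV. ?g i (t $ i)) = (\<Prod>i\<in>UNIV. exp (\<i> * of_int (m i) * of_real (t $ i)))"
      by (intro prod.cong) (auto simp: torus_box_def)
    with True show ?thesis by (simp add: g[symmetric] e_def monomial_def torus_point_def prod.distrib)
  next
    case False
    then obtain i where "t $ i \<notin> {-pi<..pi}" by (auto simp: torus_box_def)
    then have "(\<Prod>i\<in>UNIV. ?g i (t $ i)) = 0" by (intro prod_zero) (auto intro!: exI[of _ i])
    with False show ?thesis by simp
  qed
  have ms: "torus_box \<inter> space lborel \<in> sets lborel" by simp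
  show "integrable (restrict_space lborel torus_box) (\<lambda>t. e k t * cnj (e l t))"
    unfolding integrable_restrict_space[OF ms] eq by (rule lborel_integral_prod_vec integral_circle_character)+
  have "(LINT t|restrict_space lborel torus_box. e k t * cnj (e l t)) = (\<Prod>i\<in>UNIV. if m i = 0 then complex_of_real (2 * pi) else 0)"
    unfolding integral_restrict_space[OF ms] eq
    by (subst lborel_integral_prod_vec) (simp_all only: integral_circle_character if_distrib[of complex_of_real] of_real_0)
  also have "\<dots> = (if k = l then of_real ((2 * pi) ^ CARD('d)) else 0)"
  proof (cases "k = l")
    case False
    then obtain i where "k $ i \<noteq> l $ i" by (auto simp: vec_eq_iff)
    then have "m i \<noteq> 0" by (simp add: m_def)
    then show ?thesis using False by (auto intro!: prod_zero)
  qed (simp add: m_def)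
  finally show "(LINT t|restrict_space lborel torus_box. e k t * cnj (e l t)) = (if k = l then of_real ((2 * pi) ^ CARD('d)) else 0)" .
qed

lemma torus_parseval:
  fixes c :: "nat ^ 'd::finite \<Rightarrow> complex"
  assumes "finite F"
  shows "(\<integral>\<^sup>+t\<in>torus_box. ennreal ((cmod (\<Sum>k\<in>F. c k * monomial (torus_point t) k))\<^sup>2) \<partial>lborel)
    = ennreal ((2 * pi) ^ CARD('d) * (\<Sum>k\<in>F. (cmod (c k))\<^sup>2))"
  using integral_norm_sum_orthogonal[OF assms torus_orthogonal] by (simp add: nn_integral_restrict_space)

text \<open>Parseval's identity for the constant function 1.\<close>

lemma emeasure_torus_box: "emeasure lborel (torus_box :: (real ^ 'd::finite) set) = ennreal ((2 * pi) ^ CARD('d))"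
  using torus_parseval[of "{0 :: nat ^ 'd}" "\<lambda>_. 1"] by (simp add: monomial_def)

section \<open>Power series of the quotient\<close>

definition vscale :: "complex \<Rightarrow> complex ^ 'd::finite \<Rightarrow> complex ^ 'd" where
  "vscale c w = (\<chi> i. c * w $ i)"

lemma vscale_nth [simp]: "vscale c w $ i = c * w $ i"
  by (simp add: vscale_def)

lemma monomial_vscale: "monomial (vscale c w) k = c ^ mdeg k * monomial w k"
  by (simp add: monomial_def power_mult_distrib prod.distrib mdeg_def power_sum)

lemma hom_part_vscale: "hom_part \<psi> (vscale c w) m = c ^ m * hom_part \<psi> w m"
  unfolding hom_part_def sum_distrib_left by (intro sum.cong) (auto simp: monomial_vscale)

definition cpolydisc :: "real \<Rightarrow> (complex ^ 'd::finite) set" where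
  "cpolydisc r = {z. \<forall>i. cmod (z $ i) \<le> r}"

text \<open>Both \<open>G\<close> and the series \<open>P\<close> of homogeneous parts solve
  \<open>A * X = T\<close> in formal power series: \<open>G\<close> because expansions are unique,
  \<open>P\<close> by \<open>hom_part_rec\<close>. Since \<open>0 \<notin> R\<close>,
  \<open>A\<close> has constant term 1 and can be cancelled.\<close>

lemma fps_nth_slice:
  fixes w :: "complex ^ 'd::finite"
  assumes R: "finite R" "0 \<notin> R" and S: "finite S"
    and g: "g has_fps_expansion G"
    and eq: "eventually (\<lambda>x. ar_poly R \<phi> (vscale x w) * g x = ma_poly S \<theta> (vscale x w)) (nhds 0)"
  shows "fps_nth G m = hom_part (arma_coeff R \<phi> S \<theta>) w m"
proof -
  define \<psi> where "\<psi> = arma_coeff R \<phi> S \<theta>"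
  define A where "A = 1 - (\<Sum>n\<in>R. fps_const (\<phi> n * monomial w n) * fps_X ^ mdeg n)"
  define T where "T = 1 + (\<Sum>n\<in>S. fps_const (\<theta> n * monomial w n) * fps_X ^ mdeg n)"
  define P where "P = Abs_fps (hom_part \<psi> w)"
  have *: "(\<lambda>x. c * (x ^ j * d)) has_fps_expansion fps_const (c * d) * fps_X ^ j" for c d :: complex and j
    using has_fps_expansion_mult[OF has_fps_expansion_const[of "c * d"] has_fps_expansion_fps_X_power[of j]]
    by (simp add: mult_ac)
  have "(\<lambda>x. ar_poly R \<phi> (vscale x w)) has_fps_expansion A"
    unfolding ar_poly_def monomial_vscale A_def
    by (intro fps_expansion_intros has_fps_expansion_sum R *)
  then have AG: "(\<lambda>x. ar_poly R \<phi> (vscale x w) * g x) has_fps_expansion A * G"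
    by (intro has_fps_expansion_mult g)
  have T: "(\<lambda>x. ma_poly S \<theta> (vscale x w)) has_fps_expansion T"
    unfolding ma_poly_def monomial_vscale T_def
    by (intro fps_expansion_intros has_fps_expansion_sum S *)
  have "(\<lambda>x. ma_poly S \<theta> (vscale x w)) has_fps_expansion A * G"
    using has_fps_expansion_cong[OF eq refl] AG by blast
  with T have "A * G = T" using fps_expansion_unique_complex by blast
  moreover have "A * P = T"
  proof (rule fps_ext)
    fix m
    have "fps_nth (A * P) m = hom_part \<psi> w m -
      (\<Sum>n\<in>R. if mdeg n \<le> m then \<phi> n * monomial w n * hom_part \<psi> w (m - mdeg n) else 0)"
      by (auto simp: A_def P_def left_diff_distrib sum_distrib_right fps_sum_nth fps_X_power_mult_nth mult.assoc
          intro!: sum.cong)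
    also have "\<dots> = fps_nth T m"
      unfolding \<psi>_def hom_part_rec[OF R S]
      by (auto simp: T_def fps_sum_nth intro!: sum.cong)
    finally show "fps_nth (A * P) m = fps_nth T m" .
  qed
  moreover have "A \<noteq> 0"
  proof -
    have "(\<Sum>n\<in>R. fps_nth (fps_const (\<phi> n * monomial w n) * fps_X ^ mdeg n) 0) = 0"
      using R by (intro sum.neutral) (auto simp: mdeg_eq_0_iff)
    then have "fps_nth A 0 = 1" by (simp add: A_def fps_sum_nth)
    then show ?thesis by auto
  qed
  ultimately have "G = P" by (metis mult_left_cancel)
  then show ?thesis by (simp add: P_def \<psi>_def)
qed

text \<open>The common setting of both cases: \<open>\<rho> > 1\<close> with the explicit quotient
  in case (i), arbitrary \<open>\<rho> < 1\<close> with the Hardy function in case (ii). Holomorphy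
  is demanded along complex lines only, in the form in which the one-variable Cauchy inequality on
  the unit disc takes it.\<close>

locale arma_quotient =
  fixes R S :: "(nat ^ 'd::finite) set" and \<phi> \<theta> :: "nat ^ 'd \<Rightarrow> complex"
    and f :: "complex ^ 'd \<Rightarrow> complex" and \<rho> C :: real
  assumes R: "finite R" "0 \<notin> R" and S: "finite S" and \<rho>: "\<rho> > 0"
    and slice: "w \<in> cpolydisc \<rho> \<Longrightarrow> (\<lambda>x. f (vscale x w)) holomorphic_on ball 0 1"
      "w \<in> cpolydisc \<rho> \<Longrightarrow> continuous_on (cball 0 1) (\<lambda>x. f (vscale x w))"
    and bound: "z \<in> cpolydisc \<rho> \<Longrightarrow> cmod (f z) \<le> C"
    and quot: "z \<in> cpolydisc \<rho> \<Longrightarrow> ar_poly R \<phi> z * f z = ma_poly S \<theta> z"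
begin

definition quot_coeff where "quot_coeff = arma_coeff R \<phi> S \<theta>"

lemma C_nonneg: "0 \<le> C"
proof -
  have "cmod (f 0) \<le> C" by (rule bound) (use \<rho> in \<open>simp add: cpolydisc_def\<close>)
  then show ?thesis using norm_ge_zero[of "f 0"] by linarith
qed

lemma vscale_cpolydisc: "w \<in> cpolydisc \<rho> \<Longrightarrow> cmod x \<le> 1 \<Longrightarrow> vscale x w \<in> cpolydisc \<rho>"
  using mult_mono[of "cmod x" 1 _ \<rho>] by (auto simp: cpolydisc_def norm_mult)

lemma hom_part_eq_deriv:
  assumes w: "w \<in> cpolydisc \<rho>"
  shows "hom_part quot_coeff w m = (deriv ^^ m) (\<lambda>x. f (vscale x w)) 0 / fact m"
proof -
  let ?g = "\<lambda>x. f (vscale x w)"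
  have g: "?g has_fps_expansion fps_expansion ?g 0"
    by (rule has_fps_expansion_fps_expansion[OF _ _ slice(1)[OF w]]) auto
  have "eventually (\<lambda>x. x \<in> ball 0 1) (nhds (0 :: complex))"
    by (rule eventually_nhds_in_open) auto
  then have "eventually (\<lambda>x. ar_poly R \<phi> (vscale x w) * ?g x = ma_poly S \<theta> (vscale x w)) (nhds 0)"
    by eventually_elim (use w in \<open>auto intro!: quot vscale_cpolydisc\<close>)
  from fps_nth_slice[OF R S g this] show ?thesis
    using fps_nth_fps_expansion[OF g] by (simp add: quot_coeff_def)
qed

lemma norm_hom_part_le:
  assumes w: "w \<in> cpolydisc \<rho>"
  shows "cmod (hom_part quot_coeff w m) \<le> C"
proof -
  have "norm ((deriv ^^ m) (\<lambda>x. f (vscale x w)) 0) \<le> fact m * C / 1 ^ m"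
    by (rule Cauchy_inequality[OF slice[OF w]]) (auto intro!: bound vscale_cpolydisc w)
  then show ?thesis by (simp add: hom_part_eq_deriv[OF w] norm_divide divide_le_eq mult_ac)
qed

text \<open>On the torus of radius \<open>\<rho>\<close> the homogeneous part of degree
  \<open>mdeg k\<close> is bounded by \<open>C\<close>, so Parseval bounds the sum of all
  \<open>(cmod (?c k))\<^sup>2\<close> of that degree by \<open>C\<^sup>2\<close>. A single
  coefficient is one term of this sum, and no factor counting the multi-indices is lost.\<close>

lemma norm_coeff_le: "cmod (quot_coeff k) * \<rho> ^ mdeg k \<le> C"
proof -
  define m where "m = mdeg k"
  define F where "F = {k :: nat ^ 'd. mdeg k = m}"
  let ?c = "\<lambda>k. quot_coeff k * of_real \<rho> ^ m"
  have F: "finite F" by (simp add: F_def finite_mdeg_eq)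
  let ?P = "(2 * pi) ^ CARD('d)"
  have *: "(\<Sum>k\<in>F. ?c k * monomial (torus_point t) k) = hom_part quot_coeff (vscale (of_real \<rho>) (torus_point t)) m" for t
    unfolding hom_part_vscale by (simp add: hom_part_def F_def sum_distrib_left mult_ac)
  have "ennreal (?P * (\<Sum>k\<in>F. (cmod (?c k))\<^sup>2)) \<le> (\<integral>\<^sup>+t\<in>(torus_box :: (real ^ 'd) set). ennreal (C\<^sup>2) \<partial>lborel)"
    unfolding torus_parseval[OF F, symmetric] *
    by (intro nn_integral_mono mult_right_mono ennreal_leI power_mono norm_hom_part_le)
      (use \<rho> in \<open>auto simp: cpolydisc_def norm_mult\<close>)
  also have "\<dots> = ennreal (?P * C\<^sup>2)"
    by (subst nn_integral_cmult_indicator) (auto simp: emeasure_torus_box ennreal_mult'[symmetric] mult.commute)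
  finally have "(\<Sum>k\<in>F. (cmod (?c k))\<^sup>2) \<le> C\<^sup>2"
    by (subst (asm) ennreal_le_iff) auto
  moreover have "(cmod (?c k))\<^sup>2 \<le> (\<Sum>k\<in>F. (cmod (?c k))\<^sup>2)"
    by (rule member_le_sum[OF _ _ F]) (auto simp: F_def m_def)
  ultimately have "(cmod (?c k))\<^sup>2 \<le> C\<^sup>2" by linarith
  then have "cmod (?c k) \<le> C" using C_nonneg power2_le_imp_le by blast
  then show ?thesis using \<rho> by (simp add: norm_mult norm_power m_def)
qed

lemma summable_coeff:
  assumes "0 \<le> r" "r < \<rho>"
  shows "(\<lambda>k. cmod (quot_coeff k) * r ^ mdeg k) summable_on UNIV"
proof -
  have "(\<lambda>k :: nat ^ 'd. C * (r / \<rho>) ^ mdeg k) summable_on UNIV"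
    using assms \<rho> by (intro summable_on_cmult_right summable_on_power_mdeg) auto
  then show ?thesis
  proof (rule summable_on_comparison_test)
    fix k :: "nat ^ 'd"
    have "cmod (quot_coeff k) * r ^ mdeg k = cmod (quot_coeff k) * \<rho> ^ mdeg k * (r / \<rho>) ^ mdeg k"
      using \<rho> by (simp add: power_divide)
    also have "\<dots> \<le> C * (r / \<rho>) ^ mdeg k"
      using assms \<rho> by (intro mult_right_mono norm_coeff_le) auto
    finally show "cmod (quot_coeff k) * r ^ mdeg k \<le> C * (r / \<rho>) ^ mdeg k" .
  qed (use assms in auto)
qed

text \<open>The Taylor series along the line through \<open>z\<close> sums the homogeneous parts to
  \<open>f z\<close>. Absolute summability permits regrouping the multi-index series by degree, so
  its sum must be the same value.\<close>

lemma has_sum_power_series: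
  assumes r: "r < \<rho>" and z: "z \<in> cpolydisc r"
  shows "((\<lambda>k. quot_coeff k * monomial z k) has_sum f z) UNIV"
proof -
  have r0: "0 \<le> r" using z norm_ge_zero order_trans unfolding cpolydisc_def by blast
  \<comment> \<open>Here \<open>z = x w\<close> with \<open>w\<close> in the polydisc of radius
    \<open>\<rho>\<close> and \<open>0 < x < 1\<close>, so the Taylor series is evaluated inside the
    disc. The intermediate radius \<open>q\<close>, in place of \<open>r\<close>, keeps
    \<open>x\<close> positive when \<open>r = 0\<close>.\<close>
  define q where "q = (r + \<rho>) / 2"
  have q: "r < q" "q < \<rho>" "0 < q" using r r0 by (auto simp: q_def)
  define x where "x = q / \<rho>"
  have x: "0 < x" "x < 1" "\<rho> * x = q" using q \<rho> by (auto simp: x_def)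
  define w where "w = vscale (of_real (1 / x)) z"
  have zw: "vscale (of_real x) w = z" using x by (simp add: w_def vec_eq_iff)
  have w: "w \<in> cpolydisc \<rho>"
  proof -
    have "cmod (z $ i) \<le> \<rho> * x" for i using z q x unfolding cpolydisc_def by (auto intro: order_trans less_imp_le)
    then show ?thesis using x by (auto simp: cpolydisc_def w_def norm_mult norm_divide divide_le_eq)
  qed
  have "(\<lambda>m. (deriv ^^ m) (\<lambda>x. f (vscale x w)) 0 / fact m * (of_real x - 0) ^ m) sums f (vscale (of_real x) w)"
    by (rule holomorphic_power_series[OF slice(1)[OF w]]) (use x in auto)
  then have sums: "(\<lambda>m. hom_part quot_coeff z m) sums f z"
    unfolding hom_part_eq_deriv[OF w, symmetric] zw[symmetric] hom_part_vscale by (simp add: zw mult.commute)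
  have "(\<lambda>k. cmod (quot_coeff k * monomial z k)) summable_on UNIV"
  proof (rule summable_on_comparison_test[OF summable_coeff[OF r0 r]])
    show "cmod (quot_coeff k * monomial z k) \<le> cmod (quot_coeff k) * r ^ mdeg k" for k
      unfolding norm_mult by (intro mult_left_mono norm_monomial_le) (use z in \<open>auto simp: cpolydisc_def\<close>)
  qed auto
  then have "(\<lambda>k. quot_coeff k * monomial z k) summable_on UNIV" by (rule abs_summable_summable)
  then obtain s where s: "((\<lambda>k. quot_coeff k * monomial z k) has_sum s) UNIV" by (auto simp: summable_on_def)
  \<comment> \<open>Each multi-index is paired with its degree, which makes the grouping by degree
    an iterated sum.\<close>
  have "(((\<lambda>k. quot_coeff k * monomial z k) \<circ> snd) has_sum s) (SIGMA m:UNIV. {k. mdeg k = m})"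
  proof (subst has_sum_reindex[symmetric])
    show "inj_on snd (SIGMA m:UNIV. {k :: nat ^ 'd. mdeg k = m})" by (auto simp: inj_on_def)
    have "snd ` (SIGMA m:UNIV. {k :: nat ^ 'd. mdeg k = m}) = UNIV" by (auto simp: image_iff)
    then show "((\<lambda>k. quot_coeff k * monomial z k) has_sum s) (snd ` (SIGMA m:UNIV. {k. mdeg k = m}))" using s by simp
  qed
  then have "((\<lambda>m. hom_part quot_coeff z m) has_sum s) UNIV"
    by (rule has_sum_SigmaD) (auto simp: hom_part_def intro!: has_sum_finite finite_mdeg_eq)
  then have "(\<lambda>m. hom_part quot_coeff z m) sums s" by (rule has_sum_imp_sums)
  with sums have "s = f z" by (rule sums_unique2[symmetric])
  with s show ?thesis by simp
qed

end

section \<open>Continuity, compactness and exhaustion of polydiscs\<close>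

lemma continuous_on_ar_poly [continuous_intros]: "continuous_on A (ar_poly R \<phi>)"
  unfolding ar_poly_def by (intro continuous_on_diff continuous_on_sum continuous_on_mult continuous_on_const continuous_on_monomial)

lemma continuous_on_ma_poly [continuous_intros]: "continuous_on A (ma_poly S \<theta>)"
  unfolding ma_poly_def by (intro continuous_on_add continuous_on_sum continuous_on_mult continuous_on_const continuous_on_monomial)

lemma norm_le_of_cpolydisc:
  fixes z :: "complex ^ 'd::finite" and r :: real
  assumes "z \<in> cpolydisc r"
  shows "norm z \<le> real CARD('d) * r"
proof -
  have "norm z \<le> (\<Sum>i\<in>UNIV. cmod (z $ i))"
    unfolding norm_vec_def by (rule L2_set_le_sum) auto
  also have "\<dots> \<le> (\<Sum>i\<in>(UNIV :: 'd set). r)"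
    by (rule sum_mono) (use assms in \<open>auto simp: cpolydisc_def\<close>)
  finally show ?thesis by simp
qed

lemma compact_cpolydisc: "compact (cpolydisc r :: (complex ^ 'd::finite) set)"
proof -
  have "bounded (cpolydisc r :: (complex ^ 'd) set)"
    using norm_le_of_cpolydisc unfolding bounded_iff by blast
  moreover have "closed (cpolydisc r :: (complex ^ 'd) set)"
    unfolding cpolydisc_def by (intro closed_Collect_all closed_Collect_le continuous_intros)
  ultimately show ?thesis by (simp add: compact_eq_bounded_closed)
qed

lemma cpolydisc_subset_polydisc: "r < 1 \<Longrightarrow> cpolydisc r \<subseteq> polydisc"
  by (auto simp: cpolydisc_def polydisc_def intro: le_less_trans)

lemma polydisc_obtain_radius:
  assumes "z \<in> polydisc"
  obtains r where "0 < r" "r < 1" "z \<in> cpolydisc r"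
proof
  \<comment> \<open>The entry \<open>1/2\<close> keeps the radius positive when
    \<open>z = 0\<close>.\<close>
  define r where "r = Max (insert (1/2) (range (\<lambda>i. cmod (z $ i))))"
  show "0 < r" unfolding r_def by (subst Max_gr_iff) auto
  show "r < 1" unfolding r_def by (subst Max_less_iff) (use assms in \<open>auto simp: polydisc_def\<close>)
  have "cmod (z $ i) \<le> r" for i unfolding r_def by (rule Max_ge) auto
  then show "z \<in> cpolydisc r" by (simp add: cpolydisc_def)
qed

text \<open>Each point is approached from inside along the segment to the origin, by the factors
  \<open>1 - 1 / (n + 1)\<close>.\<close>

lemma cpolydisc_1_subset: "cpolydisc 1 \<subseteq> closure (polydisc :: (complex ^ 'd::finite) set)"
proof
  fix z :: "complex ^ 'd" assume z: "z \<in> cpolydisc 1"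
  let ?x = "\<lambda>n. (1 - inverse (real (Suc n))) *\<^sub>R z"
  have "?x n \<in> polydisc" for n
  proof -
    have "\<bar>1 - inverse (real (Suc n))\<bar> * cmod (z $ i) < 1" for i
    proof -
      have "\<bar>1 - inverse (real (Suc n))\<bar> * cmod (z $ i) \<le> \<bar>1 - inverse (real (Suc n))\<bar> * 1"
        using z by (intro mult_left_mono) (auto simp: cpolydisc_def)
      also have "\<dots> < 1" by (simp add: abs_if field_simps)
      finally show ?thesis .
    qed
    then show ?thesis by (simp add: polydisc_def)
  qed
  moreover have "?x \<longlonglongrightarrow> (1 - 0) *\<^sub>R z"
    by (rule tendsto_scaleR[OF tendsto_diff[OF tendsto_const LIMSEQ_inverse_real_of_nat] tendsto_const])
  then have "?x \<longlonglongrightarrow> z" by (simp only: diff_zero scaleR_one)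
  ultimately have "(\<forall>n. ?x n \<in> polydisc) \<and> ?x \<longlonglongrightarrow> z" by simp
  then show "z \<in> closure polydisc" unfolding closure_sequential by (rule exI[of _ ?x])
qed

section \<open>Case (i): zero-free polynomial and geometric decay of the coefficients\<close>

lemma nonvanishing_on_larger_polydisc:
  fixes \<phi> :: "nat ^ 'd::finite \<Rightarrow> complex"
  assumes "\<forall>z \<in> closure polydisc. ar_poly R \<phi> z \<noteq> 0"
  obtains \<rho> where "\<rho> > 1" "\<And>z. z \<in> cpolydisc \<rho> \<Longrightarrow> ar_poly R \<phi> z \<noteq> 0"
proof -
  let ?K = "cpolydisc 1 :: (complex ^ 'd) set"
  have "open {z. ar_poly R \<phi> z \<noteq> 0}"
    by (intro open_Collect_neq continuous_on_ar_poly continuous_on_const)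
  moreover have "?K \<subseteq> {z. ar_poly R \<phi> z \<noteq> 0}" using assms cpolydisc_1_subset by blast
  ultimately obtain e where e: "e > 0" "(\<Union>x\<in>?K. cball x e) \<subseteq> {z. ar_poly R \<phi> z \<noteq> 0}"
    using compact_subset_open_imp_cball_epsilon_subset[OF compact_cpolydisc] by blast
  \<comment> \<open>Rescaling a point of the larger polydisc to the unit one moves it by
    \<open>(\<rho> - 1) * norm x\<close>, where \<open>norm x \<le> CARD('d)\<close>. This radius
    makes the displacement at most \<open>e\<close>, the width of the zero-free
    neighbourhood.\<close>
  define \<rho> where "\<rho> = 1 + e / CARD('d)"
  have \<rho>: "\<rho> > 1" using e by (simp add: \<rho>_def)
  have "ar_poly R \<phi> z \<noteq> 0" if z: "z \<in> cpolydisc \<rho>" for z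
  proof -
    define x where "x = (1 / \<rho>) *\<^sub>R z"
    have xK: "x \<in> ?K" using z \<rho> by (auto simp: cpolydisc_def x_def divide_le_eq)
    have "x - z = (1 - \<rho>) *\<^sub>R x" using \<rho> by (simp add: scaleR_diff_left) (simp add: x_def)
    then have "dist x z = (\<rho> - 1) * norm x" using \<rho> by (simp add: dist_norm)
    also have "\<dots> \<le> (\<rho> - 1) * (CARD('d) * 1)"
      using \<rho> norm_le_of_cpolydisc[OF xK] by (intro mult_left_mono) auto
    also have "\<dots> = e" by (simp add: \<rho>_def)
    finally have "z \<in> cball x e" by simp
    with e xK show ?thesis by blast
  qed
  with \<rho> that show ?thesis by blast
qed

lemma coeff_decay_of_nonvanishing:
  fixes \<phi> \<theta> :: "nat ^ 'd::finite \<Rightarrow> complex"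
  assumes R: "finite R" "0 \<notin> R" and S: "finite S"
    and nz: "\<forall>z \<in> closure polydisc. ar_poly R \<phi> z \<noteq> 0"
  defines "\<psi> \<equiv> arma_coeff R \<phi> S \<theta>"
  obtains \<rho> C where "\<rho> > 1" "\<And>k. cmod (\<psi> k) * \<rho> ^ mdeg k \<le> C"
    "\<And>z. z \<in> polydisc \<Longrightarrow> ((\<lambda>k. \<psi> k * monomial z k) has_sum ma_poly S \<theta> z / ar_poly R \<phi> z) UNIV"
proof -
  obtain \<rho> where gt1: "\<rho> > 1" and nz: "\<And>z. z \<in> cpolydisc \<rho> \<Longrightarrow> ar_poly R \<phi> z \<noteq> 0"
    using nonvanishing_on_larger_polydisc[OF nz] by blast
  let ?f = "\<lambda>z. ma_poly S \<theta> z / ar_poly R \<phi> z"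
  have "compact (?f ` cpolydisc \<rho>)"
    by (intro compact_continuous_image compact_cpolydisc continuous_on_divide continuous_on_ar_poly continuous_on_ma_poly) (use nz in auto)
  then have "bounded (?f ` cpolydisc \<rho>)" by (rule compact_imp_bounded)
  then obtain C where C: "\<And>z. z \<in> cpolydisc \<rho> \<Longrightarrow> cmod (?f z) \<le> C"
    unfolding bounded_iff by blast
  have vs: "vscale x w \<in> cpolydisc \<rho>" if "w \<in> cpolydisc \<rho>" "cmod x \<le> 1" for x and w :: "complex ^ 'd"
    using that gt1 mult_mono[of "cmod x" 1 _ \<rho>] by (auto simp: cpolydisc_def norm_mult)
  interpret arma_quotient R S \<phi> \<theta> ?f \<rho> C
  proof
    fix w :: "complex ^ 'd" assume w: "w \<in> cpolydisc \<rho>"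
    have n: "ar_poly R \<phi> (vscale x w) \<noteq> 0" if "cmod x \<le> 1" for x using vs nz w that by blast
    show "(\<lambda>x. ?f (vscale x w)) holomorphic_on ball 0 1"
      \<comment> \<open>On a complex line numerator and denominator are polynomials in
        \<open>x\<close>.\<close>
      using n unfolding ma_poly_def ar_poly_def monomial_vscale by (intro holomorphic_intros) auto
    show "continuous_on (cball 0 1) (\<lambda>x. ?f (vscale x w))"
      using n unfolding ma_poly_def ar_poly_def monomial_vscale by (intro continuous_intros) auto
  qed (use R S gt1 C nz in auto)
  show ?thesis
  proof (rule that[OF gt1])
    show "cmod (\<psi> k) * \<rho> ^ mdeg k \<le> C" for k using norm_coeff_le unfolding \<psi>_def quot_coeff_def .
    fix z :: "complex ^ 'd" assume "z \<in> polydisc"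
    then have "z \<in> cpolydisc 1" by (auto simp: cpolydisc_def polydisc_def less_imp_le)
    then show "((\<lambda>k. \<psi> k * monomial z k) has_sum ?f z) UNIV"
      using has_sum_power_series[OF gt1] unfolding \<psi>_def quot_coeff_def by simp
  qed
qed

text \<open>Allows unordered sums to be evaluated along one sequence of finite index sets, as the
  sequential limit theorems of integration require.\<close>

lemma filterlim_mdeg_le:
  "filterlim (\<lambda>n. {k :: nat ^ 'd::finite. mdeg k \<le> n}) (finite_subsets_at_top UNIV) sequentially"
  unfolding filterlim_finite_subsets_at_top
proof (intro allI impI)
  fix X :: "(nat ^ 'd) set" assume X: "finite X \<and> X \<subseteq> UNIV"
  have "eventually (\<lambda>n. Max (insert 0 (mdeg ` X)) \<le> n) sequentially" by (rule eventually_ge_at_top)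
  then show "eventually (\<lambda>n. finite {k :: nat ^ 'd. mdeg k \<le> n} \<and> X \<subseteq> {k. mdeg k \<le> n} \<and> {k. mdeg k \<le> n} \<subseteq> UNIV) sequentially"
    by eventually_elim (use X in \<open>auto simp: finite_mdeg_le\<close>)
qed

text \<open>Parseval on the torus of radius \<open>r < 1\<close> bounds every finite sum of
  \<open>(cmod (\<psi> k))\<^sup>2 * r ^ (2 * mdeg k)\<close> by the squared Hardy norm. On a fixed
  finite index set \<open>r\<close> can then tend to 1.\<close>

lemma coeff_square_summable_of_hardy2:
  fixes \<phi> \<theta> :: "nat ^ 'd::finite \<Rightarrow> complex"
  assumes R: "finite R" "0 \<notin> R" and S: "finite S"
    and f: "f \<in> hardy2" and quot: "\<forall>z \<in> polydisc. ar_poly R \<phi> z * f z = ma_poly S \<theta> z"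
  defines "\<psi> \<equiv> arma_coeff R \<phi> S \<theta>"
  shows "\<And>z. z \<in> polydisc \<Longrightarrow> ((\<lambda>k. \<psi> k * monomial z k) has_sum f z) UNIV"
    and "(\<lambda>k. (cmod (\<psi> k))\<^sup>2) summable_on UNIV"
proof -
  from f have hol: "holomorphic_several f polydisc" by (simp add: hardy2_def)
  have contf: "continuous_on polydisc f"
    using hol unfolding holomorphic_several_def
    by (intro continuous_at_imp_continuous_on ballI) (blast intro: has_derivative_continuous)
  have vs: "vscale x w \<in> polydisc" if "w \<in> cpolydisc r" "cmod x \<le> 1" "r < 1" for x r and w :: "complex ^ 'd"
  proof -
    have "cmod x * cmod (w $ i) < 1" for i
    proof -
      have "cmod x * cmod (w $ i) \<le> 1 * cmod (w $ i)" using that by (intro mult_right_mono) auto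
      also have "\<dots> < 1" using that by (auto simp: cpolydisc_def intro: le_less_trans)
      finally show ?thesis .
    qed
    then show ?thesis by (simp add: polydisc_def norm_mult)
  qed
  have slice: "(\<lambda>x. f (vscale x w)) field_differentiable (at x)"
    if "vscale x w \<in> polydisc" for x w
  proof -
    obtain c :: "complex ^ 'd" where c: "(f has_derivative (\<lambda>h. \<Sum>i\<in>UNIV. c $ i * h $ i)) (at (vscale x w))"
      using hol \<open>vscale x w \<in> polydisc\<close> unfolding holomorphic_several_def by blast
    have "((\<lambda>x. vscale x w) has_derivative (\<lambda>h. vscale h w)) (at x)"
      by (intro bounded_linear_imp_has_derivative linear_conv_bounded_linear[THEN iffD1] linearI)
        (auto simp: vec_eq_iff algebra_simps)
    from diff_chain_at[OF this c]
    \<comment> \<open>By the chain rule the derivative along the line is multiplication by one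
      complex number, because the derivative of \<open>f\<close> is complex linear.\<close>
    have "((\<lambda>x. f (vscale x w)) has_derivative (\<lambda>h. (\<Sum>i\<in>UNIV. c $ i * w $ i) * h)) (at x)"
      by (simp add: o_def sum_distrib_left mult_ac)
    then show ?thesis unfolding field_differentiable_def has_field_derivative_def by blast
  qed
  have ex: "\<exists>C. arma_quotient R S \<phi> \<theta> f r C" if r: "0 < r" "r < 1" for r
  proof -
    have "compact (f ` cpolydisc r)"
      using contf cpolydisc_subset_polydisc r
      by (intro compact_continuous_image compact_cpolydisc) (blast intro: continuous_on_subset)
    then have "bounded (f ` cpolydisc r)" by (rule compact_imp_bounded)
    then obtain C where C: "\<And>z. z \<in> cpolydisc r \<Longrightarrow> cmod (f z) \<le> C"
      unfolding bounded_iff by blast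
    have "arma_quotient R S \<phi> \<theta> f r C"
    proof
      fix w :: "complex ^ 'd" assume w: "w \<in> cpolydisc r"
      have fd: "(\<lambda>x. f (vscale x w)) field_differentiable (at x within A)" if "cmod x \<le> 1" for x A
        using slice vs w r that by (blast intro: field_differentiable_at_within)
      show "(\<lambda>x. f (vscale x w)) holomorphic_on ball 0 1"
        unfolding holomorphic_on_def by (auto intro!: fd)
      have "(\<lambda>x. f (vscale x w)) holomorphic_on cball 0 1"
        unfolding holomorphic_on_def by (auto intro!: fd)
      then show "continuous_on (cball 0 1) (\<lambda>x. f (vscale x w))" by (rule holomorphic_on_imp_continuous_on)
    qed (use R S r C quot cpolydisc_subset_polydisc in auto)
    then show ?thesis ..
  qed
  have hs: "((\<lambda>k. \<psi> k * monomial z k) has_sum f z) UNIV \<and> (\<lambda>k. cmod (\<psi> k) * r ^ mdeg k) summable_on UNIV"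
    if r: "0 < r" "r < 1" and z: "z \<in> cpolydisc r" for r z
  proof -
    \<comment> \<open>The locale yields the series only strictly inside its polydisc, so it is
      instantiated at a radius between \<open>r\<close> and 1.\<close>
    have "0 < (r + 1) / 2" "(r + 1) / 2 < 1" "r < (r + 1) / 2" using r by auto
    with ex obtain C where "arma_quotient R S \<phi> \<theta> f ((r + 1) / 2) C" by blast
    then interpret arma_quotient R S \<phi> \<theta> f "(r + 1) / 2" C .
    show ?thesis
      using has_sum_power_series[OF \<open>r < (r + 1) / 2\<close> z] summable_coeff[of r] r
      unfolding \<psi>_def quot_coeff_def by auto
  qed
  show sum: "((\<lambda>k. \<psi> k * monomial z k) has_sum f z) UNIV" if "z \<in> polydisc" for z
    using polydisc_obtain_radius[OF that] hs by metis
  let ?I = "\<lambda>r. \<integral>\<^sup>+t\<in>(torus_box :: (real ^ 'd) set). ennreal ((cmod (f (vscale (of_real r) (torus_point t))))\<^sup>2) \<partial>lborel"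
  let ?P = "(2 * pi) ^ CARD('d)"
  define H where "H = (SUP r\<in>{0..<1}. ennreal (1 / ?P) * ?I r)"
  have Hfin: "H < \<infinity>"
    using f unfolding hardy2_def H_def vscale_def torus_point_def torus_box_def by simp
  have partial: "(\<Sum>k\<in>F. (cmod (\<psi> k))\<^sup>2 * r ^ (2 * mdeg k)) \<le> enn2real H" if F: "finite F" and r: "0 < r" "r < 1" for F r
  proof -
    let ?z = "\<lambda>t :: real ^ 'd. vscale (of_real r) (torus_point t)"
    define c where "c k = \<psi> k * of_real r ^ mdeg k" for k
    define s where "s n t = (\<Sum>k | mdeg k \<le> n. c k * monomial (torus_point t) k)" for n t
    have z: "?z t \<in> cpolydisc r" for t using r by (simp add: cpolydisc_def norm_mult)
    have ck: "c k * monomial (torus_point t) k = \<psi> k * monomial (?z t) k" for k t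
      by (simp add: c_def monomial_vscale)
    have nc: "cmod (c k) = cmod (\<psi> k) * r ^ mdeg k" for k
      using r by (simp add: c_def norm_mult norm_power)
    have summ: "(\<lambda>k. cmod (c k)) summable_on UNIV" unfolding nc using hs[OF r z] by blast
    define B where "B = infsum (\<lambda>k. cmod (c k)) UNIV"
    have sB: "cmod (s n t) \<le> B" for n t
    proof -
      have "cmod (s n t) \<le> (\<Sum>k | mdeg k \<le> n. cmod (c k))"
        unfolding s_def
      proof (rule order_trans[OF norm_sum sum_mono])
        show "cmod (c k * monomial (torus_point t) k) \<le> cmod (c k)" for k
          using norm_monomial_le[of "torus_point t" 1 k] by (simp add: norm_mult mult_left_le)
      qed
      also have "\<dots> \<le> B" unfolding B_def
        by (rule finite_sum_le_infsum[OF summ finite_mdeg_le]) auto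
      finally show ?thesis .
    qed
    have lim: "(\<lambda>n. s n t) \<longlonglongrightarrow> f (?z t)" for t
    proof -
      have "((\<lambda>k. c k * monomial (torus_point t) k) has_sum f (?z t)) UNIV"
        unfolding ck using hs[OF r z] by blast
      from filterlim_compose[OF this[unfolded has_sum_def] filterlim_mdeg_le] show ?thesis
        by (simp add: s_def)
    qed
    let ?L = "restrict_space lborel (torus_box :: (real ^ 'd) set)"
    have cm: "continuous_on UNIV (\<lambda>t :: real ^ 'd. monomial (torus_point t) k)" for k
      by (rule continuous_on_compose2[OF continuous_on_monomial[of UNIV] continuous_on_torus_point]) simp
    have ms [measurable]: "s n \<in> borel_measurable ?L" for n
      unfolding s_def
      by (intro measurable_restrict_space1 borel_measurable_sum borel_measurable_times)
        (auto simp: borel_measurable_continuous_onI[OF cm])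
    have mf: "(\<lambda>t. f (?z t)) \<in> borel_measurable ?L"
      by (rule borel_measurable_LIMSEQ_metric[OF ms lim])
    \<comment> \<open>The truncations are bounded by \<open>B\<close> uniformly in \<open>n\<close>
      and \<open>t\<close>, and the torus has finite measure, so dominated convergence carries
      Parseval from the truncations to \<open>f\<close>.\<close>
    have "(\<lambda>n. \<integral>\<^sup>+t. ennreal ((cmod (s n t))\<^sup>2) \<partial>?L) \<longlonglongrightarrow> (\<integral>\<^sup>+t. ennreal ((cmod (f (?z t)))\<^sup>2) \<partial>?L)"
    proof (rule nn_integral_dominated_convergence[where w = "\<lambda>_. ennreal (B\<^sup>2)"])
      show "(\<lambda>t. ennreal ((cmod (f (?z t)))\<^sup>2)) \<in> borel_measurable ?L" using mf by measurable
      show "(\<lambda>t. ennreal ((cmod (s n t))\<^sup>2)) \<in> borel_measurable ?L" for n by measurable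
      show "AE t in ?L. ennreal ((cmod (s n t))\<^sup>2) \<le> ennreal (B\<^sup>2)" for n
        by (intro AE_I2 ennreal_leI power_mono sB) auto
      show "(\<integral>\<^sup>+t. ennreal (B\<^sup>2) \<partial>?L) < \<infinity>"
        by (simp add: emeasure_restrict_space emeasure_torus_box ennreal_mult_less_top)
      show "AE t in ?L. (\<lambda>n. ennreal ((cmod (s n t))\<^sup>2)) \<longlonglongrightarrow> ennreal ((cmod (f (?z t)))\<^sup>2)"
        by (intro AE_I2 tendsto_ennrealI tendsto_intros lim)
    qed auto
    then have lim2: "(\<lambda>n. ennreal (?P * (\<Sum>k | mdeg k \<le> n. (cmod (c k))\<^sup>2))) \<longlonglongrightarrow> ?I r"
      unfolding s_def by (simp add: nn_integral_restrict_space torus_parseval finite_mdeg_le)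
    have "eventually (\<lambda>n. F \<subseteq> {k. mdeg k \<le> n}) sequentially"
      using filterlim_mdeg_le[unfolded filterlim_finite_subsets_at_top, rule_format, of F] F
      by (auto elim: eventually_mono)
    then have "eventually (\<lambda>n. ennreal (?P * (\<Sum>k\<in>F. (cmod (c k))\<^sup>2)) \<le> ennreal (?P * (\<Sum>k | mdeg k \<le> n. (cmod (c k))\<^sup>2))) sequentially"
      by eventually_elim (intro ennreal_leI mult_left_mono sum_mono2 finite_mdeg_le; auto)
    with lim2 have le: "ennreal (?P * (\<Sum>k\<in>F. (cmod (c k))\<^sup>2)) \<le> ?I r"
      by (intro tendsto_lowerbound) auto
    have "ennreal (\<Sum>k\<in>F. (cmod (c k))\<^sup>2) = ennreal (1 / ?P) * ennreal (?P * (\<Sum>k\<in>F. (cmod (c k))\<^sup>2))"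
      by (simp add: ennreal_mult'[symmetric])
    also have "\<dots> \<le> ennreal (1 / ?P) * ?I r" by (intro mult_left_mono le) auto
    also have "\<dots> \<le> H" unfolding H_def by (rule SUP_upper) (use r in auto)
    finally have "enn2real (ennreal (\<Sum>k\<in>F. (cmod (c k))\<^sup>2)) \<le> enn2real H"
      by (rule enn2real_mono) (use Hfin in auto)
    then have "(\<Sum>k\<in>F. (cmod (c k))\<^sup>2) \<le> enn2real H"
      by (simp add: sum_nonneg)
    then show ?thesis by (simp add: nc power_mult_distrib flip: power_mult) (simp add: mult.commute)
  qed
  show "(\<lambda>k. (cmod (\<psi> k))\<^sup>2) summable_on UNIV"
  proof (rule nonneg_bdd_above_summable_on)
    show "bdd_above (sum (\<lambda>k. (cmod (\<psi> k))\<^sup>2) ` {F. F \<subseteq> UNIV \<and> finite F})"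
    proof (rule bdd_aboveI2)
      fix F :: "(nat ^ 'd) set" assume "F \<in> {F. F \<subseteq> UNIV \<and> finite F}"
      then have F: "finite F" by simp
      \<comment> \<open>The double successor starts the radii at 1/2, since \<open>partial\<close>
        asks for \<open>0 < r\<close>.\<close>
      let ?r = "\<lambda>n. 1 - inverse (real (Suc (Suc n)))"
      have "?r \<longlonglongrightarrow> 1 - 0"
        by (rule tendsto_diff[OF tendsto_const LIMSEQ_Suc[OF LIMSEQ_inverse_real_of_nat]])
      then have "(\<lambda>n. \<Sum>k\<in>F. (cmod (\<psi> k))\<^sup>2 * ?r n ^ (2 * mdeg k)) \<longlonglongrightarrow> (\<Sum>k\<in>F. (cmod (\<psi> k))\<^sup>2 * (1 - 0) ^ (2 * mdeg k))"
        by (intro tendsto_sum tendsto_mult tendsto_const tendsto_power)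
      then have "(\<lambda>n. \<Sum>k\<in>F. (cmod (\<psi> k))\<^sup>2 * ?r n ^ (2 * mdeg k)) \<longlonglongrightarrow> (\<Sum>k\<in>F. (cmod (\<psi> k))\<^sup>2)"
        by simp
      then show "(\<Sum>k\<in>F. (cmod (\<psi> k))\<^sup>2) \<le> enn2real H"
        by (rule LIMSEQ_le_const2) (intro exI[of _ 0] allI impI partial F; simp add: field_simps)
    qed
  qed auto
qed

section \<open>Causal linear random fields\<close>

lemma lag_le: "lag t k \<le> t"
  by (simp add: lag_def less_eq_vec_def)

lemma lag_0 [simp]: "lag t 0 = t"
  by (simp add: lag_def vec_eq_iff)

lemma lag_shift: "lag (t + h) k = lag t k + h"
  by (simp add: lag_def)

lemma lag_lag: "lag (lag t n) k = lag t (k + n)"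
  by (simp add: lag_def vec_eq_iff)

lemma lag_eq_iff [simp]: "lag t k = lag t l \<longleftrightarrow> k = l"
  by (simp add: lag_def vec_eq_iff)

text \<open>Defined for every \<open>\<omega>\<close>, with a fixed default value of
  \<open>lim\<close> where the sequence diverges. Hence the field is measurable for the past itself
  without any correction on null sets, and each value is the same functional of the shifted
  noise.\<close>

definition lim_field :: "(nat \<Rightarrow> (nat ^ 'd::finite) set) \<Rightarrow> (nat ^ 'd \<Rightarrow> complex) \<Rightarrow>
    (int ^ 'd \<Rightarrow> 'w \<Rightarrow> complex) \<Rightarrow> int ^ 'd \<Rightarrow> 'w \<Rightarrow> complex" where
  "lim_field F \<psi> Z t \<omega> = lim (\<lambda>j. \<Sum>k\<in>F j. \<psi> k * Z (lag t k) \<omega>)"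

locale iid_random_field = prob_space M for M :: "'w measure" +
  fixes Z :: "int ^ 'd::finite \<Rightarrow> 'w \<Rightarrow> complex"
  assumes iid: "iid_field M Z"
begin

lemma indep_Z: "indep_vars (\<lambda>_. borel) Z UNIV"
  using iid by (simp add: iid_field_def)

lemma distr_Z: "distr M borel (Z s) = distr M borel (Z t)"
  using iid by (simp add: iid_field_def)

lemma Z_measurable [measurable]: "Z s \<in> borel_measurable M"
  using indep_Z by (simp add: indep_vars_def)

lemma Z_measurable_past: "s \<le> t \<Longrightarrow> Z s \<in> borel_measurable (past_sigma M Z t)"
  unfolding past_sigma_def
  by (rule measurableI) (auto intro!: sigma_sets.Basic simp: sets_measure_of_conv space_measure_of_conv)

lemma lim_field_measurable_past: "lim_field F \<psi> Z t \<in> borel_measurable (past_sigma M Z t)"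
  unfolding lim_field_def
  by (intro borel_measurable_lim_metric borel_measurable_sum borel_measurable_times borel_measurable_const
      Z_measurable_past lag_le)

lemma lim_field_measurable [measurable]: "lim_field F \<psi> Z t \<in> borel_measurable M"
  unfolding lim_field_def by measurable

text \<open>By independence the joint law is a product measure; its factors coincide, so an
  injective reindexing leaves it unchanged.\<close>

lemma distr_shift:
  "distr M (\<Pi>\<^sub>M s\<in>UNIV. borel) (\<lambda>\<omega> s. Z (s + h) \<omega>) = distr M (\<Pi>\<^sub>M s\<in>UNIV. borel) (\<lambda>\<omega> s. Z s \<omega>)"
proof -
  define N where "N = distr M borel (Z 0)"
  have N: "distr M borel (Z s) = N" for s unfolding N_def by (rule distr_Z)
  interpret N: prob_space N unfolding N_def by (rule prob_space_distr) simp
  have sets_N: "sets (\<Pi>\<^sub>M s\<in>(UNIV :: (int ^ 'd) set). N) = sets (\<Pi>\<^sub>M s\<in>UNIV. borel)"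
    by (intro sets_PiM_cong) (auto simp: N_def)
  have mZ: "(\<lambda>\<omega> s. Z s \<omega>) \<in> measurable M (\<Pi>\<^sub>M s\<in>UNIV. borel)"
    by (rule measurable_PiM_single') auto
  have mS: "(\<lambda>x s. x (s + h)) \<in> measurable (\<Pi>\<^sub>M s\<in>(UNIV :: (int ^ 'd) set). borel) (\<Pi>\<^sub>M s\<in>UNIV. borel :: complex measure)"
    by (rule measurable_PiM_single') (auto intro!: measurable_component_singleton)
  have PZ: "distr M (\<Pi>\<^sub>M s\<in>UNIV. borel) (\<lambda>\<omega> s. Z s \<omega>) = (\<Pi>\<^sub>M s\<in>UNIV. N)"
    using indep_vars_iff_distr_eq_PiM[of UNIV Z "\<lambda>_. borel"] indep_Z by (simp add: N restrict_UNIV)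
  have "distr M (\<Pi>\<^sub>M s\<in>UNIV. borel) (\<lambda>\<omega> s. Z (s + h) \<omega>)
      = distr (distr M (\<Pi>\<^sub>M s\<in>UNIV. borel) (\<lambda>\<omega> s. Z s \<omega>)) (\<Pi>\<^sub>M s\<in>UNIV. borel) (\<lambda>x s. x (s + h))"
    by (subst distr_distr[OF mS mZ]) (simp add: o_def)
  also have "\<dots> = distr (\<Pi>\<^sub>M s\<in>UNIV. N) (\<Pi>\<^sub>M s\<in>UNIV. N) (\<lambda>x. \<lambda>s\<in>UNIV. x (s + h))"
    unfolding PZ by (intro distr_cong) (simp_all add: sets_N restrict_UNIV)
  also have "\<dots> = (\<Pi>\<^sub>M s\<in>UNIV. N)"
    by (rule distr_PiM_reindex) (auto intro: N.prob_space_axioms simp: inj_on_def)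
  finally show ?thesis unfolding PZ .
qed

text \<open>By \<open>lag_shift\<close>, the values at \<open>t + h\<close> arise by applying one
  measurable map \<open>G\<close> to the noise shifted by \<open>h\<close>, whose law does not
  depend on \<open>h\<close>. The unshifted side is the instance \<open>h = 0\<close>.\<close>

lemma lim_field_stationary: "strictly_stationary M (lim_field F \<psi> Z)"
  unfolding strictly_stationary_def
proof (intro conjI allI impI)
  fix J :: "(int ^ 'd) set" and h assume "finite J"
  define G where "G x = (\<lambda>t\<in>J. lim (\<lambda>j. \<Sum>k\<in>F j. \<psi> k * x (lag t k)))" for x :: "int ^ 'd \<Rightarrow> complex"
  have G: "G \<in> measurable (\<Pi>\<^sub>M s\<in>UNIV. borel) (\<Pi>\<^sub>M t\<in>J. borel)"
    unfolding G_def by (rule measurable_restrict) measurable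
  have m: "(\<lambda>\<omega> s. Z (s + h) \<omega>) \<in> measurable M (\<Pi>\<^sub>M s\<in>UNIV. borel)" for h
    by (rule measurable_PiM_single') auto
  have *: "distr M (\<Pi>\<^sub>M t\<in>J. borel) (\<lambda>\<omega>. \<lambda>t\<in>J. lim_field F \<psi> Z (t + h) \<omega>)
      = distr (distr M (\<Pi>\<^sub>M s\<in>UNIV. borel) (\<lambda>\<omega> s. Z (s + h) \<omega>)) (\<Pi>\<^sub>M t\<in>J. borel) G" for h
    by (subst distr_distr[OF G m]) (simp add: o_def G_def lim_field_def lag_shift)
  show "distr M (\<Pi>\<^sub>M t\<in>J. borel) (\<lambda>\<omega>. \<lambda>t\<in>J. lim_field F \<psi> Z (t + h) \<omega>)
      = distr M (\<Pi>\<^sub>M t\<in>J. borel) (\<lambda>\<omega>. \<lambda>t\<in>J. lim_field F \<psi> Z t \<omega>)"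
    unfolding * distr_shift using *[of 0, symmetric] by simp
qed simp

end

section \<open>Almost sure convergence under a logarithmic moment\<close>

lemma log_plus_nonneg: "0 \<le> log_plus x"
  by (simp add: log_plus_def)

lemma log_plus_measurable [measurable]: "log_plus \<in> borel_measurable borel"
  unfolding log_plus_def by measurable

lemma less_log_plus: "exp y < x \<Longrightarrow> y < log_plus x"
proof -
  assume x: "exp y < x"
  then have "y < ln x" by (metis ln_exp ln_less_cancel_iff exp_gt_zero less_trans)
  moreover have "x \<noteq> 0" using x exp_gt_zero[of y] by linarith
  ultimately show ?thesis by (simp add: log_plus_def less_max_iff_disj)
qed

text \<open>A pathwise statement: the series are shifted and combined linearly, and the coefficient
  of \<open>x (lag t k)\<close> is then the left side of \<open>arma_coeff_rec\<close>, which
  vanishes outside \<open>insert 0 S\<close>.\<close>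

lemma arma_of_has_sum:
  fixes x y :: "int ^ 'd::finite \<Rightarrow> complex" and \<phi> \<theta> :: "nat ^ 'd \<Rightarrow> complex"
  assumes R: "finite R" "0 \<notin> R" and S: "finite S" "0 \<notin> S"
  defines "\<psi> \<equiv> arma_coeff R \<phi> S \<theta>"
  assumes y: "\<And>n. n \<in> insert 0 R \<Longrightarrow> ((\<lambda>k. \<psi> k * x (lag (lag t n) k)) has_sum y (lag t n)) UNIV"
  shows "y t - (\<Sum>n\<in>R. \<phi> n * y (lag t n)) = x t + (\<Sum>n\<in>S. \<theta> n * x (lag t n))"
proof -
  let ?s = "\<lambda>n k. (if n \<le> k then \<phi> n * \<psi> (k - n) else 0) * x (lag t k)"
  have s: "(?s n has_sum \<phi> n * y (lag t n)) UNIV" if "n \<in> R" for n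
  proof -
    \<comment> \<open>The lagged series is indexed by the \<open>k = j + n\<close> and extended by
      zero to all \<open>k\<close>, so that the different lags can be added termwise.\<close>
    have "((\<lambda>j. \<phi> n * (\<psi> j * x (lag t (j + n)))) has_sum \<phi> n * y (lag t n)) UNIV"
      using y[of n] that by (intro has_sum_cmult_right) (simp add: lag_lag)
    moreover have "(\<lambda>j. \<phi> n * (\<psi> j * x (lag t (j + n)))) = ?s n \<circ> (\<lambda>j. j + n)"
      by (auto simp: fun_eq_iff less_eq_vec_def)
    ultimately have "(?s n has_sum \<phi> n * y (lag t n)) (range (\<lambda>j. j + n))"
      by (subst has_sum_reindex) (auto simp: inj_on_def)
    moreover have "k \<in> range (\<lambda>j. j + n)" if "n \<le> k" for k
      using diff_add_vec[OF that] by (metis rangeI)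
    ultimately show ?thesis
      by (subst has_sum_cong_neutral[where T = "range (\<lambda>j. j + n)" and g = "?s n"]) auto
  qed
  have "((\<lambda>k. \<Sum>n\<in>R. ?s n k) has_sum (\<Sum>n\<in>R. \<phi> n * y (lag t n))) UNIV"
    using R(1) s
  proof (induction R rule: finite_induct)
    case (insert n R)
    then show ?case by (auto intro!: has_sum_add)
  qed simp
  moreover have "((\<lambda>k. \<psi> k * x (lag t k)) has_sum y t) UNIV" using y[of 0] by simp
  ultimately have "((\<lambda>k. \<psi> k * x (lag t k) + - 1 * (\<Sum>n\<in>R. ?s n k)) has_sum (y t + - 1 * (\<Sum>n\<in>R. \<phi> n * y (lag t n)))) UNIV"
    by (intro has_sum_add has_sum_cmult_right)
  moreover have "\<psi> k * x (lag t k) + - 1 * (\<Sum>n\<in>R. ?s n k)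
      = ((if k = 0 then 1 else 0) + (if k \<in> S then \<theta> k else 0)) * x (lag t k)" for k
    unfolding arma_coeff_rec[OF R(2), of \<phi> S \<theta> k, symmetric] \<psi>_def
    by (simp add: sum_distrib_right left_diff_distrib)
  ultimately have "((\<lambda>k. ((if k = 0 then 1 else 0) + (if k \<in> S then \<theta> k else 0)) * x (lag t k)) has_sum
      (y t + - 1 * (\<Sum>n\<in>R. \<phi> n * y (lag t n)))) UNIV" by simp
  moreover have "((\<lambda>k. ((if k = 0 then 1 else 0) + (if k \<in> S then \<theta> k else 0)) * x (lag t k)) has_sum
      (x t + (\<Sum>n\<in>S. \<theta> n * x (lag t n)))) UNIV"
  proof (rule has_sum_finite_neutralI[where B = "insert 0 S"])
    have "(\<Sum>k\<in>S. ((if k = 0 then 1 else 0) + (if k \<in> S then \<theta> k else 0)) * x (lag t k)) = (\<Sum>n\<in>S. \<theta> n * x (lag t n))"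
      using S by (intro sum.cong) auto
    then show "x t + (\<Sum>n\<in>S. \<theta> n * x (lag t n)) = (\<Sum>k\<in>insert 0 S. ((if k = 0 then 1 else 0) + (if k \<in> S then \<theta> k else 0)) * x (lag t k))"
      using S by simp
  qed (use S in auto)
  ultimately show ?thesis using has_sum_unique by fastforce
qed

section \<open>Counting large noise values under the logarithmic moment\<close>

lemma card_mdeg_less:
  fixes a x :: real
  assumes "0 < a" "0 \<le> x"
  shows "finite {k :: nat ^ 'd::finite. a * real (mdeg k) < x}"
    and "real (card {k :: nat ^ 'd. a * real (mdeg k) < x}) \<le> (x / a + 1) ^ CARD('d)"
proof -
  define m where "m = nat \<lfloor>x / a\<rfloor>"
  have sub: "{k :: nat ^ 'd. a * real (mdeg k) < x} \<subseteq> {k. mdeg k \<le> m}"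
  proof safe
    fix k :: "nat ^ 'd" assume "a * real (mdeg k) < x"
    then have "real (mdeg k) \<le> x / a" using assms by (simp add: field_simps)
    then show "mdeg k \<le> m" unfolding m_def by (simp add: le_nat_floor)
  qed
  show "finite {k :: nat ^ 'd. a * real (mdeg k) < x}" by (rule finite_subset[OF sub finite_mdeg_le])
  have "card {k :: nat ^ 'd. a * real (mdeg k) < x} \<le> card {k :: nat ^ 'd. mdeg k \<le> m}"
    by (rule card_mono[OF finite_mdeg_le sub])
  also have "\<dots> \<le> (m + 1) ^ CARD('d)" by (rule card_mdeg_le)
  finally have "real (card {k :: nat ^ 'd. a * real (mdeg k) < x}) \<le> real ((m + 1) ^ CARD('d))"
    by (rule of_nat_mono)
  also have "\<dots> = (real m + 1) ^ CARD('d)" by (simp add: add.commute)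
  also have "\<dots> \<le> (x / a + 1) ^ CARD('d)"
    using assms by (intro power_mono add_right_mono) (auto simp: m_def of_nat_nat)
  finally show "real (card {k :: nat ^ 'd. a * real (mdeg k) < x}) \<le> (x / a + 1) ^ CARD('d)" .
qed

context iid_random_field
begin

lemma nn_integral_Z_cong:
  assumes "g \<in> borel_measurable borel"
  shows "(\<integral>\<^sup>+\<omega>. g (Z s \<omega>) \<partial>M) = (\<integral>\<^sup>+\<omega>. g (Z t \<omega>) \<partial>M)"
proof -
  have "(\<integral>\<^sup>+\<omega>. g (Z s \<omega>) \<partial>M) = (\<integral>\<^sup>+z. g z \<partial>distr M borel (Z s))" for s
    by (rule nn_integral_distr[symmetric]) (use assms in auto)
  then show ?thesis using distr_Z[of s t] by simp
qed

text \<open>Borel-Cantelli in integrated form: by Tonelli and equality of the marginal laws, the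
  expected number of \<open>k\<close> with \<open>a * mdeg k < log_plus (cmod (Z (lag t k)))\<close>
  equals the expected number with \<open>Z 0\<close> in every place. For a fixed value of
  \<open>Z 0\<close> this is a lattice point count of order
  \<open>log_plus ^ CARD('d)\<close>.\<close>

lemma AE_finite_large:
  assumes int: "integrable M (\<lambda>\<omega>. log_plus (cmod (Z 0 \<omega>)) ^ CARD('d))" and a: "a > 0"
  shows "AE \<omega> in M. finite {k. exp (a * real (mdeg k)) < cmod (Z (lag t k) \<omega>)}"
proof -
  define g where "g k z = (indicator {z. a * real (mdeg k) < log_plus (cmod z)} z :: ennreal)"
    for k :: "nat ^ 'd" and z
  have g [measurable]: "g k \<in> borel_measurable borel" for k unfolding g_def by measurable
  \<comment> \<open>Joint measurability reduces to measurability for each \<open>k\<close>, as there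
    are countably many multi-indices. It makes the inner integral over \<open>k\<close> measurable
    in \<open>\<omega>\<close>.\<close>
  have "(\<lambda>(k, \<omega>). g k (Z (lag t k) \<omega>)) \<in> borel_measurable (count_space UNIV \<Otimes>\<^sub>M M)"
    by (rule measurable_pair_measure_countable1) auto
  from measurable_compose[OF measurable_pair_swap' this]
  have pm: "(\<lambda>(\<omega>, k). g k (Z (lag t k) \<omega>)) \<in> borel_measurable (M \<Otimes>\<^sub>M count_space UNIV)"
    by (simp add: case_prod_beta)
  have "(\<integral>\<^sup>+\<omega>. \<integral>\<^sup>+k. g k (Z (lag t k) \<omega>) \<partial>count_space UNIV \<partial>M)
      = (\<integral>\<^sup>+k. \<integral>\<^sup>+\<omega>. g k (Z (lag t k) \<omega>) \<partial>M \<partial>count_space UNIV)"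
    by (rule nn_integral_count_space_nn_integral) auto
  also have "\<dots> = (\<integral>\<^sup>+k. \<integral>\<^sup>+\<omega>. g k (Z 0 \<omega>) \<partial>M \<partial>count_space UNIV)"
    by (intro nn_integral_cong nn_integral_Z_cong g)
  also have "\<dots> = (\<integral>\<^sup>+\<omega>. \<integral>\<^sup>+k. g k (Z 0 \<omega>) \<partial>count_space UNIV \<partial>M)"
    by (rule nn_integral_count_space_nn_integral[symmetric]) auto
  also have "\<dots> \<le> (\<integral>\<^sup>+\<omega>. ennreal (2 ^ CARD('d) * (1 + (1 / a) ^ CARD('d) * log_plus (cmod (Z 0 \<omega>)) ^ CARD('d))) \<partial>M)"
  proof (rule nn_integral_mono)
    fix \<omega>
    let ?L = "log_plus (cmod (Z 0 \<omega>))"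
    let ?A = "{k :: nat ^ 'd. a * real (mdeg k) < ?L}"
    have "(\<integral>\<^sup>+k. g k (Z 0 \<omega>) \<partial>count_space UNIV) = (\<integral>\<^sup>+k. indicator ?A k \<partial>count_space UNIV)"
      by (intro nn_integral_cong) (simp add: g_def indicator_def)
    also have "\<dots> = emeasure (count_space UNIV) ?A" by simp
    also have "\<dots> = of_nat (card ?A)"
      by (intro emeasure_count_space_finite card_mdeg_less(1)[OF a log_plus_nonneg]) simp
    also have "\<dots> = ennreal (card ?A)" by (rule ennreal_of_nat_eq_real_of_nat)
    also have "\<dots> \<le> ennreal ((?L / a + 1) ^ CARD('d))"
      by (intro ennreal_leI card_mdeg_less(2)[OF a log_plus_nonneg])
    also have "\<dots> \<le> ennreal (2 ^ CARD('d) * (1 + (1 / a) ^ CARD('d) * ?L ^ CARD('d)))"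
    proof (rule ennreal_leI)
      \<comment> \<open>With \<open>u = ?L / a\<close>, the chain
        \<open>(u + 1)^d \<le> (2 max(1, u))^d \<le> 2^d (1 + u^d)\<close> leaves only the assumed
        moment.\<close>
      let ?m = "max 1 (?L / a)"
      have "(?L / a + 1) ^ CARD('d) \<le> (2 * ?m) ^ CARD('d)"
        using a log_plus_nonneg[of "cmod (Z 0 \<omega>)"] by (intro power_mono) auto
      also have "\<dots> = 2 ^ CARD('d) * ?m ^ CARD('d)" by (simp add: power_mult_distrib)
      also have "?m ^ CARD('d) \<le> 1 + (?L / a) ^ CARD('d)"
        using a log_plus_nonneg[of "cmod (Z 0 \<omega>)"] by (auto simp: max_def)
      also have "(?L / a) ^ CARD('d) = (1 / a) ^ CARD('d) * ?L ^ CARD('d)"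
        by (simp add: power_divide)
      finally show "(?L / a + 1) ^ CARD('d) \<le> 2 ^ CARD('d) * (1 + (1 / a) ^ CARD('d) * ?L ^ CARD('d))"
        by simp
    qed
    finally show "(\<integral>\<^sup>+k. g k (Z 0 \<omega>) \<partial>count_space UNIV) \<le> ennreal (2 ^ CARD('d) * (1 + (1 / a) ^ CARD('d) * ?L ^ CARD('d)))" .
  qed
  also have "\<dots> < \<infinity>"
  proof -
    have "integrable M (\<lambda>\<omega>. 2 ^ CARD('d) * (1 + (1 / a) ^ CARD('d) * log_plus (cmod (Z 0 \<omega>)) ^ CARD('d)))"
      by (intro integrable_mult_right Bochner_Integration.integrable_add integrable_const int)
    then show ?thesis
      by (subst nn_integral_eq_integral) (use a in \<open>auto simp: log_plus_nonneg intro!: AE_I2 mult_nonneg_nonneg add_nonneg_nonneg\<close>)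
  qed
  finally have "AE \<omega> in M. (\<integral>\<^sup>+k. g k (Z (lag t k) \<omega>) \<partial>count_space UNIV) \<noteq> \<infinity>"
    by (intro nn_integral_PInf_AE sigma_finite_measure.borel_measurable_nn_integral[OF sigma_finite_measure_count_space] pm) auto
  then show ?thesis
  proof eventually_elim
    case (elim \<omega>)
    let ?B = "{k. a * real (mdeg k) < log_plus (cmod (Z (lag t k) \<omega>))}"
    have "(\<integral>\<^sup>+k. g k (Z (lag t k) \<omega>) \<partial>count_space UNIV) = (\<integral>\<^sup>+k. indicator ?B k \<partial>count_space UNIV)"
      by (intro nn_integral_cong) (simp add: g_def indicator_def)
    also have "\<dots> = emeasure (count_space UNIV) ?B" by simp
    finally have fin: "emeasure (count_space UNIV) ?B \<noteq> \<infinity>" using elim by simp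
    have "finite ?B"
    proof (rule ccontr)
      assume "infinite ?B"
      then have "emeasure (count_space UNIV) ?B = \<infinity>" by (intro emeasure_count_space_infinite) simp
      with fin show False by simp
    qed
    then show ?case by (rule rev_finite_subset) (auto intro: less_log_plus)
  qed
qed

lemma AE_summable:
  assumes int: "integrable M (\<lambda>\<omega>. log_plus (cmod (Z 0 \<omega>)) ^ CARD('d))"
    and \<rho>: "\<rho> > 1" and C: "\<And>k. cmod (\<psi> k) * \<rho> ^ mdeg k \<le> C"
  shows "AE \<omega> in M. (\<lambda>k. \<psi> k * Z (lag t k) \<omega>) summable_on UNIV"
proof -
  \<comment> \<open>Half of the exponential decay rate of \<open>\<psi>\<close> is spent on the
    growth \<open>exp (a * mdeg k)\<close> allowed to the noise; the other half remains as the ratio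
    \<open>q = exp (- a) < 1\<close>.\<close>
  define a where "a = ln \<rho> / 2"
  have a: "a > 0" using \<rho> by (simp add: a_def)
  define q where "q = exp (- a)"
  have q: "0 < q" "q < 1" using a by (auto simp: q_def)
  have \<rho>q: "\<rho> * q = exp a"
  proof -
    have "\<rho> = exp (2 * a)" using \<rho> by (simp add: a_def)
    then show ?thesis by (simp add: q_def exp_add[symmetric])
  qed
  show ?thesis using AE_finite_large[OF int a, of t]
  proof eventually_elim
    case (elim \<omega>)
    let ?z = "\<lambda>k. Z (lag t k) \<omega>"
    let ?E = "{k. exp (a * real (mdeg k)) < cmod (?z k)}"
    \<comment> \<open>The majorant is a geometric series plus the finitely many exceptional terms,
      kept as they are.\<close>
    have "(\<lambda>k. C * q ^ mdeg k + (if k \<in> ?E then cmod (\<psi> k * ?z k) else 0)) summable_on UNIV"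
      using q elim
      by (intro summable_on_add summable_on_cmult_right summable_on_power_mdeg finite_nonzero_values_imp_summable_on)
        (auto elim: rev_finite_subset)
    then have "(\<lambda>k. cmod (\<psi> k * ?z k)) summable_on UNIV"
    proof (rule summable_on_comparison_test)
      fix k
      have "cmod (\<psi> 0) \<le> C" using C[of 0] by simp
      then have C0: "0 \<le> C" using norm_ge_zero order_trans by blast
      show "cmod (\<psi> k * ?z k) \<le> C * q ^ mdeg k + (if k \<in> ?E then cmod (\<psi> k * ?z k) else 0)"
      proof (cases "k \<in> ?E")
        case False
        then have "cmod (?z k) \<le> exp (a * real (mdeg k))" by simp
        also have "\<dots> = (\<rho> * q) ^ mdeg k" by (simp add: \<rho>q exp_of_nat_mult[symmetric] mult.commute)
        finally have "cmod (\<psi> k * ?z k) \<le> cmod (\<psi> k) * (\<rho> * q) ^ mdeg k"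
          unfolding norm_mult by (rule mult_left_mono) simp
        also have "\<dots> = cmod (\<psi> k) * \<rho> ^ mdeg k * q ^ mdeg k" by (simp add: power_mult_distrib)
        also have "\<dots> \<le> C * q ^ mdeg k" using q by (intro mult_right_mono C) auto
        finally show ?thesis using False by simp
      qed (use C0 q in simp)
    qed auto
    then show ?case by (rule abs_summable_summable)
  qed
qed

lemma causal_solution_as:
  fixes \<phi> \<theta> :: "nat ^ 'd \<Rightarrow> complex"
  assumes R: "finite R" "0 \<notin> R" and S: "finite S" "0 \<notin> S"
    and int: "integrable M (\<lambda>\<omega>. log_plus (cmod (Z 0 \<omega>)) ^ CARD('d))"
  defines "\<psi> \<equiv> arma_coeff R \<phi> S \<theta>"
  assumes \<rho>: "\<rho> > 1" and C: "\<And>k. cmod (\<psi> k) * \<rho> ^ mdeg k \<le> C"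
  shows "\<exists>Y. causal_solution M R \<phi> S \<theta> Z Y \<and> linear_field_as M \<psi> Z Y"
proof -
  define Y where "Y = lim_field (\<lambda>n. {k. mdeg k \<le> n}) \<psi> Z"
  have hs: "AE \<omega> in M. ((\<lambda>k. \<psi> k * Z (lag t k) \<omega>) has_sum Y t \<omega>) UNIV" for t
    using AE_summable[OF int \<rho> C, of t]
  proof eventually_elim
    case (elim \<omega>)
    then obtain s where s: "((\<lambda>k. \<psi> k * Z (lag t k) \<omega>) has_sum s) UNIV" by (auto simp: summable_on_def)
    from filterlim_compose[OF this[unfolded has_sum_def] filterlim_mdeg_le]
    have "Y t \<omega> = s" unfolding Y_def lim_field_def by (rule limI)
    with s show ?case by simp
  qed
  have "AE \<omega> in M. Y t \<omega> - (\<Sum>n\<in>R. \<phi> n * Y (lag t n) \<omega>) = Z t \<omega> + (\<Sum>n\<in>S. \<theta> n * Z (lag t n) \<omega>)" for t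
  proof -
    \<comment> \<open>The equation at \<open>t\<close> involves only finitely many sites, so their
      exceptional null sets can be united.\<close>
    have "AE \<omega> in M. \<forall>n\<in>insert 0 R. ((\<lambda>k. \<psi> k * Z (lag (lag t n) k) \<omega>) has_sum Y (lag t n) \<omega>) UNIV"
      using R hs by (intro AE_finite_allI) auto
    then show ?thesis
    proof eventually_elim
      case (elim \<omega>)
      show ?case
        by (rule arma_of_has_sum[OF R S, where x = "\<lambda>s. Z s \<omega>" and y = "\<lambda>s. Y s \<omega>"])
          (use elim in \<open>auto simp: \<psi>_def\<close>)
    qed
  qed
  then have "causal_solution M R \<phi> S \<theta> Z Y"
    unfolding causal_solution_def arma_equation_def
    using lim_field_stationary lim_field_measurable_past by (auto simp: Y_def)
  moreover have "linear_field_as M \<psi> Z Y" unfolding linear_field_as_def using hs by blast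
  ultimately show ?thesis by blast
qed

end

section \<open>Mean square convergence\<close>

lemma summable_tail_small:
  fixes a :: "'a \<Rightarrow> real"
  assumes sum: "a summable_on UNIV" and nn: "\<And>k. 0 \<le> a k" and e: "0 < e"
  obtains A where "finite A" "\<And>B. finite B \<Longrightarrow> B \<inter> A = {} \<Longrightarrow> sum a B \<le> e"
proof -
  obtain s where s: "(a has_sum s) UNIV" using sum by (auto simp: summable_on_def)
  then have "eventually (\<lambda>A. dist (sum a A) s < e) (finite_subsets_at_top UNIV)"
    unfolding has_sum_def using e by (rule tendstoD)
  then obtain A where A: "finite A" "\<And>B. finite B \<Longrightarrow> A \<subseteq> B \<Longrightarrow> dist (sum a B) s < e"
    unfolding eventually_finite_subsets_at_top by auto
  have "sum a B \<le> e" if B: "finite B" "B \<inter> A = {}" for B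
  proof -
    have "sum a (A \<union> B) \<le> s"
      by (rule has_sum_mono_neutral[OF has_sum_finite s]) (use A B nn in auto)
    moreover have "s < sum a A + e" using A(2)[of A] A(1) by (auto simp: dist_real_def)
    moreover have "sum a (A \<union> B) = sum a A + sum a B"
      using A B by (intro sum.union_disjoint) auto
    ultimately show ?thesis by linarith
  qed
  with A that show ?thesis by blast
qed

lemma norm_diff_square_le: "(cmod (u - v))\<^sup>2 \<le> 2 * (cmod u)\<^sup>2 + 2 * (cmod v)\<^sup>2"
proof -
  have "(cmod (u - v))\<^sup>2 \<le> (cmod u + cmod v)\<^sup>2"
    by (intro power_mono norm_triangle_ineq4) auto
  also have "\<dots> \<le> 2 * (cmod u)\<^sup>2 + 2 * (cmod v)\<^sup>2"
    using zero_le_power2[of "cmod u - cmod v"] by (simp add: power2_eq_square algebra_simps)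
  finally show ?thesis .
qed

lemma norm_sum_square_le: "(cmod (sum f R))\<^sup>2 \<le> real (card R) * (\<Sum>n\<in>R. (cmod (f n))\<^sup>2)"
proof -
  have "(cmod (sum f R))\<^sup>2 \<le> (\<Sum>n\<in>R. cmod (f n))\<^sup>2"
    by (intro power_mono norm_sum) auto
  also have "\<dots> \<le> (\<Sum>n\<in>R. (cmod (f n))\<^sup>2) * real (card R)"
    by (rule sum_squared_le_sum_of_squares)
  finally show ?thesis by (simp add: mult.commute)
qed

section \<open>Orthogonality of the noise and almost sure convergence along a sequence\<close>

locale centred_iid_random_field = iid_random_field M Z
  for M :: "'w measure" and Z :: "int ^ 'd::finite \<Rightarrow> 'w \<Rightarrow> complex" +
  assumes square_integrable: "integrable M (\<lambda>\<omega>. (cmod (Z 0 \<omega>))\<^sup>2)"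
    and centred: "(LINT \<omega>|M. Z 0 \<omega>) = 0"
begin

definition var_Z :: real where "var_Z = (LINT \<omega>|M. (cmod (Z 0 \<omega>))\<^sup>2)"

lemma var_Z_nonneg: "0 \<le> var_Z"
  unfolding var_Z_def by (rule Bochner_Integration.integral_nonneg) simp

lemma integrable_Z_cong:
  fixes g :: "complex \<Rightarrow> 'b :: {banach, second_countable_topology}"
  assumes g: "g \<in> borel_measurable borel"
  shows "integrable M (\<lambda>\<omega>. g (Z s \<omega>)) \<longleftrightarrow> integrable M (\<lambda>\<omega>. g (Z t \<omega>))"
    and "(LINT \<omega>|M. g (Z s \<omega>)) = (LINT \<omega>|M. g (Z t \<omega>))"
proof -
  have "integrable M (\<lambda>\<omega>. g (Z s \<omega>)) \<longleftrightarrow> integrable (distr M borel (Z s)) g" for s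
    by (rule integrable_distr_eq[symmetric]) (use g in auto)
  then show "integrable M (\<lambda>\<omega>. g (Z s \<omega>)) \<longleftrightarrow> integrable M (\<lambda>\<omega>. g (Z t \<omega>))" using distr_Z[of s t] by simp
  have "(LINT \<omega>|M. g (Z s \<omega>)) = integral\<^sup>L (distr M borel (Z s)) g" for s
    by (rule integral_distr[symmetric]) (use g in auto)
  then show "(LINT \<omega>|M. g (Z s \<omega>)) = (LINT \<omega>|M. g (Z t \<omega>))" using distr_Z[of s t] by simp
qed

lemma integrable_Z: "integrable M (Z s)"
proof -
  have "integrable M (Z 0)"
  proof (rule Bochner_Integration.integrable_bound)
    show "integrable M (\<lambda>\<omega>. 1 + (cmod (Z 0 \<omega>))\<^sup>2)"
      by (intro Bochner_Integration.integrable_add integrable_const square_integrable)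
    have "x \<le> 1 + x\<^sup>2" for x :: real
    proof -
      have "2 * x \<le> 1 + x\<^sup>2" using zero_le_power2[of "x - 1"] by (simp add: power2_eq_square algebra_simps)
      moreover have "0 \<le> x\<^sup>2" by simp
      ultimately show ?thesis by linarith
    qed
    then show "AE \<omega> in M. norm (Z 0 \<omega>) \<le> norm (1 + (cmod (Z 0 \<omega>))\<^sup>2)" by (intro AE_I2) simp
  qed simp
  then show ?thesis using integrable_Z_cong(1)[of "\<lambda>z. z" s 0] by simp
qed

text \<open>For distinct sites independence factors the expectation, and a factor is zero because
  the noise is centred.\<close>

lemma Z_orthogonal:
  shows "integrable M (\<lambda>\<omega>. Z s \<omega> * cnj (Z s' \<omega>))"
    and "(LINT \<omega>|M. Z s \<omega> * cnj (Z s' \<omega>)) = (if s = s' then complex_of_real var_Z else 0)"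
proof -
  have "integrable M (\<lambda>\<omega>. Z s \<omega> * cnj (Z s' \<omega>)) \<and>
    (LINT \<omega>|M. Z s \<omega> * cnj (Z s' \<omega>)) = (if s = s' then complex_of_real var_Z else 0)"
  proof (cases "s = s'")
    case True
    have "integrable M (\<lambda>\<omega>. (cmod (Z s \<omega>))\<^sup>2)"
      using integrable_Z_cong(1)[of "\<lambda>z. (cmod z)\<^sup>2" s 0] square_integrable by simp
    moreover have "(LINT \<omega>|M. (cmod (Z s \<omega>))\<^sup>2) = var_Z"
      using integrable_Z_cong(2)[of "\<lambda>z. (cmod z)\<^sup>2" s 0] by (simp add: var_Z_def)
    ultimately show ?thesis using True
      by (simp add: complex_norm_square[symmetric] del: of_real_power)
  next
    case False
    have cnj: "cnj \<in> borel_measurable borel"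
      by (intro borel_measurable_continuous_onI continuous_intros)
    have m: "(\<lambda>x. x s) \<in> borel_measurable (\<Pi>\<^sub>M i\<in>{s}. borel)"
      "(\<lambda>x. cnj (x s')) \<in> borel_measurable (\<Pi>\<^sub>M i\<in>{s'}. borel)"
      using measurable_compose[OF measurable_component_singleton[of s' "{s'}" "\<lambda>_. borel"] cnj]
      by (auto intro: measurable_component_singleton)
    \<comment> \<open>Pairwise independence is extracted from that of the family through the
      restrictions to two disjoint singletons, with conjugation composed onto the second.\<close>
    have ind: "indep_var borel ((\<lambda>x. x s) \<circ> (\<lambda>\<omega>. \<lambda>i\<in>{s}. Z i \<omega>)) borel ((\<lambda>x. cnj (x s')) \<circ> (\<lambda>\<omega>. \<lambda>i\<in>{s'}. Z i \<omega>))"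
      by (rule indep_var_compose[OF indep_var_restrict[OF indep_Z] m]) (use False in auto)
    have eq: "(\<lambda>x. x s) \<circ> (\<lambda>\<omega>. \<lambda>i\<in>{s}. Z i \<omega>) = Z s" "(\<lambda>x. cnj (x s')) \<circ> (\<lambda>\<omega>. \<lambda>i\<in>{s'}. Z i \<omega>) = (\<lambda>\<omega>. cnj (Z s' \<omega>))"
      by (auto simp: fun_eq_iff)
    have "(LINT \<omega>|M. Z s \<omega>) = 0" using integrable_Z_cong(2)[of "\<lambda>z. z" s 0] centred by simp
    with indep_var_lebesgue_integral[OF ind[unfolded eq]] indep_var_integrable[OF ind[unfolded eq]] False
    show ?thesis by (simp add: integrable_Z)
  qed
  then show "integrable M (\<lambda>\<omega>. Z s \<omega> * cnj (Z s' \<omega>))"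
    "(LINT \<omega>|M. Z s \<omega> * cnj (Z s' \<omega>)) = (if s = s' then complex_of_real var_Z else 0)" by auto
qed

lemma nn_integral_norm_sum_square:
  assumes "finite A"
  shows "(\<integral>\<^sup>+\<omega>. ennreal ((cmod (\<Sum>k\<in>A. c k * Z (lag t k) \<omega>))\<^sup>2) \<partial>M) = ennreal (var_Z * (\<Sum>k\<in>A. (cmod (c k))\<^sup>2))"
  by (rule integral_norm_sum_orthogonal[OF assms]) (simp_all add: Z_orthogonal)

lemma nn_integral_norm_sum_diff_square:
  assumes A: "finite A" "A \<subseteq> B" "finite B"
  shows "(\<integral>\<^sup>+\<omega>. ennreal ((cmod ((\<Sum>k\<in>B. c k * Z (lag t k) \<omega>) - (\<Sum>k\<in>A. c k * Z (lag t k) \<omega>)))\<^sup>2) \<partial>M)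
    = ennreal (var_Z * (\<Sum>k\<in>B - A. (cmod (c k))\<^sup>2))"
proof -
  have "(\<Sum>k\<in>B. c k * Z (lag t k) \<omega>) - (\<Sum>k\<in>A. c k * Z (lag t k) \<omega>) = (\<Sum>k\<in>B - A. c k * Z (lag t k) \<omega>)" for \<omega>
    using A by (simp add: sum_diff)
  then show ?thesis using nn_integral_norm_sum_square[of "B - A" c t] A by simp
qed

text \<open>The increments have second moments of order \<open>(1 / 4) ^ j\<close>, hence first
  moments of order \<open>(1 / 2) ^ j\<close>. So the expected sum of their moduli is finite and the
  partial sums converge absolutely almost surely. The index sets \<open>G j\<close> are independent
  of \<open>t\<close>, as stationarity of \<open>lim_field\<close> requires.\<close>

lemma AE_partial_sums_tendsto:
  assumes fin: "\<And>j. finite (G j)" and mono: "\<And>j. G j \<subseteq> G (Suc j)"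
    and small: "\<And>j B. finite B \<Longrightarrow> B \<inter> G j = {} \<Longrightarrow> (\<Sum>k\<in>B. (cmod (\<psi> k))\<^sup>2) \<le> (1 / 4) ^ j"
  shows "AE \<omega> in M. (\<lambda>j. \<Sum>k\<in>G j. \<psi> k * Z (lag t k) \<omega>) \<longlonglongrightarrow> lim_field G \<psi> Z t \<omega>"
proof -
  define T where "T j \<omega> = (\<Sum>k\<in>G j. \<psi> k * Z (lag t k) \<omega>)" for j \<omega>
  define D where "D j \<omega> = T (Suc j) \<omega> - T j \<omega>" for j \<omega>
  have [measurable]: "T j \<in> borel_measurable M" for j unfolding T_def by measurable
  have [measurable]: "D j \<in> borel_measurable M" for j unfolding D_def by measurable
  have D1: "(\<integral>\<^sup>+\<omega>. ennreal (cmod (D j \<omega>)) \<partial>M) \<le> ennreal ((1 + var_Z) * (1 / 2) ^ j)" for j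
  proof -
    \<comment> \<open>AM-GM, weighted so that both terms have geometrically small expectation.\<close>
    have am: "x \<le> (1 / 2) ^ j + 2 ^ j * x\<^sup>2" if "0 \<le> x" for x :: real
    proof -
      have "2 ^ j * x \<le> 1 + (2 ^ j * x)\<^sup>2"
        using zero_le_power2[of "2 ^ j * x - 1"] zero_le_power2[of "2 ^ j * x"] by (simp add: power2_eq_square algebra_simps)
      then have "(1 / 2) ^ j * (2 ^ j * x) \<le> (1 / 2) ^ j * (1 + (2 ^ j * x)\<^sup>2)"
        by (intro mult_left_mono) auto
      then show ?thesis by (simp add: power2_eq_square field_simps)
    qed
    have "(\<integral>\<^sup>+\<omega>. ennreal (cmod (D j \<omega>)) \<partial>M) \<le> (\<integral>\<^sup>+\<omega>. ennreal ((1 / 2) ^ j) + ennreal (2 ^ j) * ennreal ((cmod (D j \<omega>))\<^sup>2) \<partial>M)"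
      using am by (intro nn_integral_mono) (simp add: ennreal_mult'[symmetric] ennreal_plus[symmetric] del: ennreal_plus)
    also have "\<dots> = ennreal ((1 / 2) ^ j) + ennreal (2 ^ j) * (\<integral>\<^sup>+\<omega>. ennreal ((cmod (D j \<omega>))\<^sup>2) \<partial>M)"
      by (simp add: nn_integral_add nn_integral_cmult emeasure_space_1)
    also have "(\<integral>\<^sup>+\<omega>. ennreal ((cmod (D j \<omega>))\<^sup>2) \<partial>M) = ennreal (var_Z * (\<Sum>k\<in>G (Suc j) - G j. (cmod (\<psi> k))\<^sup>2))"
      unfolding D_def T_def by (rule nn_integral_norm_sum_diff_square) (use fin mono in auto)
    also have "\<dots> \<le> ennreal (var_Z * (1 / 4) ^ j)"
      by (intro ennreal_leI mult_left_mono small var_Z_nonneg) (use fin in auto)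
    finally have "(\<integral>\<^sup>+\<omega>. ennreal (cmod (D j \<omega>)) \<partial>M) \<le> ennreal ((1 / 2) ^ j) + ennreal (2 ^ j) * ennreal (var_Z * (1 / 4) ^ j)"
      by (simp add: mult_left_mono add_left_mono)
    also have "\<dots> = ennreal ((1 / 2) ^ j + 2 ^ j * (var_Z * (1 / 4) ^ j))"
      using var_Z_nonneg by (simp add: ennreal_mult'[symmetric] ennreal_plus[symmetric] del: ennreal_plus)
    also have "(1 / 2) ^ j + 2 ^ j * (var_Z * (1 / 4) ^ j) = (1 + var_Z) * (1 / 2) ^ j"
    proof -
      have "(2 :: real) ^ j * (1 / 4) ^ j = (1 / 2) ^ j" by (simp flip: power_mult_distrib)
      then show ?thesis by (simp add: algebra_simps)
    qed
    finally show ?thesis .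
  qed
  have "(\<integral>\<^sup>+\<omega>. (\<Sum>j. ennreal (cmod (D j \<omega>))) \<partial>M) = (\<Sum>j. \<integral>\<^sup>+\<omega>. ennreal (cmod (D j \<omega>)) \<partial>M)"
    by (rule nn_integral_suminf) measurable
  also have "\<dots> \<le> (\<Sum>j. ennreal ((1 + var_Z) * (1 / 2) ^ j))"
    by (intro suminf_le D1) auto
  also have "\<dots> < \<infinity>"
    by (subst suminf_ennreal2) (use var_Z_nonneg in \<open>auto intro!: summable_mult summable_geometric\<close>)
  finally have "AE \<omega> in M. (\<Sum>j. ennreal (cmod (D j \<omega>))) \<noteq> \<infinity>"
    by (intro nn_integral_PInf_AE) auto
  then show ?thesis
  proof eventually_elim
    case (elim \<omega>)
    then have "summable (\<lambda>j. cmod (D j \<omega>))" by (intro summable_suminf_not_top) auto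
    then have "summable (\<lambda>j. D j \<omega>)" by (rule summable_norm_cancel)
    then have "convergent (\<lambda>n. \<Sum>j<n. D j \<omega>)" by (simp add: summable_iff_convergent)
    then obtain l where "(\<lambda>n. \<Sum>j<n. D j \<omega>) \<longlonglongrightarrow> l" by (auto simp: convergent_def)
    moreover have "(\<Sum>j<n. D j \<omega>) = T n \<omega> - T 0 \<omega>" for n
      unfolding D_def by (rule sum_lessThan_telescope)
    ultimately have "(\<lambda>n. T n \<omega> - T 0 \<omega>) \<longlonglongrightarrow> l" by simp
    from tendsto_add[OF this tendsto_const[of "T 0 \<omega>"]] have "(\<lambda>n. T n \<omega>) \<longlonglongrightarrow> l + T 0 \<omega>" by simp
    then have "(\<lambda>n. T n \<omega>) \<longlonglongrightarrow> lim (\<lambda>n. T n \<omega>)" by (metis limI)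
    then show ?case by (simp add: T_def lim_field_def)
  qed
qed

section \<open>Unordered mean-square convergence and the ARMA equation in mean square\<close>

definition L2_err :: "(nat ^ 'd \<Rightarrow> complex) \<Rightarrow> (int ^ 'd \<Rightarrow> 'w \<Rightarrow> complex) \<Rightarrow> int ^ 'd \<Rightarrow> (nat ^ 'd) set \<Rightarrow> ennreal" where
  "L2_err \<psi> Y t A = (\<integral>\<^sup>+\<omega>. ennreal ((cmod (Y t \<omega> - (\<Sum>k\<in>A. \<psi> k * Z (lag t k) \<omega>)))\<^sup>2) \<partial>M)"

text \<open>Fatou's lemma replaces the almost sure limit \<open>Y t\<close> by the sums over
  \<open>G j\<close>. Their squared distance from the sum over \<open>A\<close> is a tail of the
  variance series, small for every \<open>A\<close> containing \<open>A0\<close>. Thus almost sure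
  convergence along one sequence yields convergence along the net of all finite sets.\<close>

lemma L2_err_tendsto:
  assumes sum: "(\<lambda>k. (cmod (\<psi> k))\<^sup>2) summable_on UNIV"
    and G: "filterlim G (finite_subsets_at_top UNIV) sequentially"
    and Y: "AE \<omega> in M. (\<lambda>j. \<Sum>k\<in>G j. \<psi> k * Z (lag t k) \<omega>) \<longlonglongrightarrow> Y t \<omega>"
  shows "(L2_err \<psi> Y t \<longlongrightarrow> 0) (finite_subsets_at_top UNIV)"
proof (rule order_tendstoI)
  fix a :: ennreal assume "a > 0"
  then obtain r where r: "ennreal r < a" "0 < r"
    by (metis dense ennreal_cases ennreal_less_zero_iff less_top_ennreal not_less_iff_gr_or_eq top.not_eq_extremum)
  \<comment> \<open>Chosen so that \<open>var_Z * e \<le> r\<close>; the added 1 covers the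
    degenerate case \<open>var_Z = 0\<close>.\<close>
  define e where "e = r / (var_Z + 1)"
  have e: "0 < e" using r var_Z_nonneg by (simp add: e_def)
  obtain A0 where A0: "finite A0" "\<And>B. finite B \<Longrightarrow> B \<inter> A0 = {} \<Longrightarrow> (\<Sum>k\<in>B. (cmod (\<psi> k))\<^sup>2) \<le> e"
    using summable_tail_small[OF sum _ e] by auto
  have "L2_err \<psi> Y t A < a" if A: "finite A" "A0 \<subseteq> A" for A
  proof -
    let ?u = "\<lambda>j \<omega>. ennreal ((cmod ((\<Sum>k\<in>G j. \<psi> k * Z (lag t k) \<omega>) - (\<Sum>k\<in>A. \<psi> k * Z (lag t k) \<omega>)))\<^sup>2)"
    have "AE \<omega> in M. ennreal ((cmod (Y t \<omega> - (\<Sum>k\<in>A. \<psi> k * Z (lag t k) \<omega>)))\<^sup>2) = liminf (\<lambda>j. ?u j \<omega>)"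
      using Y
    proof eventually_elim
      case (elim \<omega>)
      show ?case
        by (rule lim_imp_Liminf[symmetric]) (auto intro!: tendsto_ennrealI tendsto_intros elim)
    qed
    then have "L2_err \<psi> Y t A = (\<integral>\<^sup>+\<omega>. liminf (\<lambda>j. ?u j \<omega>) \<partial>M)"
      unfolding L2_err_def by (rule nn_integral_cong_AE)
    also have "\<dots> \<le> liminf (\<lambda>j. integral\<^sup>N M (?u j))"
      by (rule nn_integral_liminf) measurable
    also have "\<dots> \<le> limsup (\<lambda>j. integral\<^sup>N M (?u j))"
      by (rule Liminf_le_Limsup) simp
    also have "\<dots> \<le> ennreal (var_Z * e)"
    proof (rule Limsup_bounded)
      have "eventually (\<lambda>j. finite (G j) \<and> A \<subseteq> G j \<and> G j \<subseteq> UNIV) sequentially"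
        using G A unfolding filterlim_finite_subsets_at_top by blast
      then show "eventually (\<lambda>j. integral\<^sup>N M (?u j) \<le> ennreal (var_Z * e)) sequentially"
      proof eventually_elim
        case (elim j)
        then have "integral\<^sup>N M (?u j) = ennreal (var_Z * (\<Sum>k\<in>G j - A. (cmod (\<psi> k))\<^sup>2))"
          using A by (intro nn_integral_norm_sum_diff_square) auto
        also have "\<dots> \<le> ennreal (var_Z * e)"
          by (intro ennreal_leI mult_left_mono A0 var_Z_nonneg) (use A elim in auto)
        finally show ?case .
      qed
    qed
    also have "\<dots> \<le> ennreal r"
      using var_Z_nonneg r by (intro ennreal_leI) (auto simp: e_def field_simps)
    also note r(1)
    finally show ?thesis .
  qed
  with A0(1) show "eventually (\<lambda>A. L2_err \<psi> Y t A < a) (finite_subsets_at_top UNIV)"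
    unfolding eventually_finite_subsets_at_top by auto
qed simp

text \<open>Finite sums satisfy the equation exactly when the index set is shifted along with the
  lag. The defect \<open>D\<close> does not depend on \<open>A\<close>, while its second moment is
  bounded by mean-square errors that vanish as \<open>A\<close> grows.\<close>

lemma arma_of_L2:
  fixes \<phi> \<theta> :: "nat ^ 'd \<Rightarrow> complex"
  assumes R: "finite R" "0 \<notin> R" and S: "finite S" "0 \<notin> S"
  defines "\<psi> \<equiv> arma_coeff R \<phi> S \<theta>"
  assumes Y [measurable]: "\<And>t. Y t \<in> borel_measurable M"
    and lim: "\<And>t. (L2_err \<psi> Y t \<longlongrightarrow> 0) (finite_subsets_at_top UNIV)"
  shows "AE \<omega> in M. Y t \<omega> - (\<Sum>n\<in>R. \<phi> n * Y (lag t n) \<omega>) = Z t \<omega> + (\<Sum>n\<in>S. \<theta> n * Z (lag t n) \<omega>)"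
proof -
  define D where "D \<omega> = Y t \<omega> - (\<Sum>n\<in>R. \<phi> n * Y (lag t n) \<omega>) - (Z t \<omega> + (\<Sum>n\<in>S. \<theta> n * Z (lag t n) \<omega>))" for \<omega>
  have [measurable]: "D \<in> borel_measurable M" unfolding D_def by measurable
  \<comment> \<open>With this index set the sum at site \<open>lag t n\<close> involves only noise
    at sites \<open>lag t k\<close> with \<open>k \<in> A\<close>, so nothing is left over at the
    boundary of \<open>A\<close>.\<close>
  define sh where "sh n A = {j. j + n \<in> A}" for n :: "nat ^ 'd" and A
  define T where "T s A \<omega> = (\<Sum>k\<in>A. \<psi> k * Z (lag s k) \<omega>)" for s A \<omega>
  have [measurable]: "T s A \<in> borel_measurable M" for s A unfolding T_def by measurable
  have fin_sh: "finite (sh n A)" if "finite A" for n A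
    unfolding sh_def using that by (rule finite_vimageI[of A "\<lambda>j. j + n", unfolded vimage_def]) (simp add: inj_on_def)
  have T: "T t A \<omega> - (\<Sum>n\<in>R. \<phi> n * T (lag t n) (sh n A) \<omega>) = Z t \<omega> + (\<Sum>n\<in>S. \<theta> n * Z (lag t n) \<omega>)"
    if A: "finite A" "insert 0 S \<subseteq> A" for A \<omega>
  proof -
    let ?s = "\<lambda>n k. (if n \<le> k then \<phi> n * \<psi> (k - n) else 0) * Z (lag t k) \<omega>"
    have "\<phi> n * T (lag t n) (sh n A) \<omega> = (\<Sum>k\<in>A. ?s n k)" for n
    proof -
      have "\<phi> n * T (lag t n) (sh n A) \<omega> = (\<Sum>j\<in>sh n A. ?s n (j + n))"
        by (auto simp: T_def lag_lag sum_distrib_left less_eq_vec_def intro!: sum.cong)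
      also have "\<dots> = (\<Sum>k\<in>(\<lambda>j. j + n) ` sh n A. ?s n k)"
        by (subst sum.reindex) (auto simp: inj_on_def)
      also have "\<dots> = (\<Sum>k\<in>A. ?s n k)"
      proof (rule sum.mono_neutral_left)
        show "\<forall>k\<in>A - (\<lambda>j. j + n) ` sh n A. ?s n k = 0"
        proof
          fix k assume k: "k \<in> A - (\<lambda>j. j + n) ` sh n A"
          have "\<not> n \<le> k"
          proof
            assume "n \<le> k"
            then have "(k - n) + n = k" by (rule diff_add_vec)
            moreover from this have "k - n \<in> sh n A" using k by (simp add: sh_def)
            ultimately have "k \<in> (\<lambda>j. j + n) ` sh n A" by (rule image_eqI[OF sym])
            then show False using k by blast
          qed
          then show "?s n k = 0" by simp
        qed
      qed (use A in \<open>auto simp: sh_def\<close>)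
      finally show ?thesis .
    qed
    then have "T t A \<omega> - (\<Sum>n\<in>R. \<phi> n * T (lag t n) (sh n A) \<omega>)
        = (\<Sum>k\<in>A. (\<psi> k - (\<Sum>n\<in>R. if n \<le> k then \<phi> n * \<psi> (k - n) else 0)) * Z (lag t k) \<omega>)"
      by (simp add: T_def left_diff_distrib sum_subtractf sum_distrib_right sum.swap[of _ A R])
    also have "\<dots> = (\<Sum>k\<in>A. ((if k = 0 then 1 else 0) + (if k \<in> S then \<theta> k else 0)) * Z (lag t k) \<omega>)"
      unfolding \<psi>_def by (simp only: arma_coeff_rec[OF R(2)])
    also have "\<dots> = (\<Sum>k\<in>insert 0 S. ((if k = 0 then 1 else 0) + (if k \<in> S then \<theta> k else 0)) * Z (lag t k) \<omega>)"
      by (rule sum.mono_neutral_right) (use A in auto)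
    also have "\<dots> = Z t \<omega> + (\<Sum>n\<in>S. ((if n = 0 then 1 else 0) + (if n \<in> S then \<theta> n else 0)) * Z (lag t n) \<omega>)"
      using S by simp
    also have "(\<Sum>n\<in>S. ((if n = 0 then 1 else 0) + (if n \<in> S then \<theta> n else 0)) * Z (lag t n) \<omega>) = (\<Sum>n\<in>S. \<theta> n * Z (lag t n) \<omega>)"
      using S by (intro sum.cong) auto
    finally show ?thesis .
  qed
  \<comment> \<open>The factors 2 come from \<open>norm_diff_square_le\<close> and
    \<open>card R\<close> from the Cauchy-Schwarz bound \<open>norm_sum_square_le\<close>.\<close>
  let ?bound = "\<lambda>A. 2 * L2_err \<psi> Y t A + (\<Sum>n\<in>R. ennreal (2 * real (card R) * (cmod (\<phi> n))\<^sup>2) * L2_err \<psi> Y (lag t n) (sh n A))"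
  have le: "(\<integral>\<^sup>+\<omega>. ennreal ((cmod (D \<omega>))\<^sup>2) \<partial>M) \<le> ?bound A" if A: "finite A" "insert 0 S \<subseteq> A" for A
  proof -
    let ?U = "\<lambda>\<omega>. Y t \<omega> - T t A \<omega>"
    let ?V = "\<lambda>n \<omega>. Y (lag t n) \<omega> - T (lag t n) (sh n A) \<omega>"
    have "(\<integral>\<^sup>+\<omega>. ennreal ((cmod (D \<omega>))\<^sup>2) \<partial>M)
      \<le> (\<integral>\<^sup>+\<omega>. 2 * ennreal ((cmod (?U \<omega>))\<^sup>2) + (\<Sum>n\<in>R. ennreal (2 * real (card R) * (cmod (\<phi> n))\<^sup>2) * ennreal ((cmod (?V n \<omega>))\<^sup>2)) \<partial>M)"
    proof (rule nn_integral_mono)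
      fix \<omega>
      have m: "ennreal (c * x\<^sup>2) = ennreal c * ennreal (x\<^sup>2)" for c x :: real
        by (rule ennreal_mult'') simp
      have "D \<omega> = ?U \<omega> - (\<Sum>n\<in>R. \<phi> n * ?V n \<omega>)"
        unfolding D_def T[OF A, symmetric] by (simp add: right_diff_distrib sum_subtractf)
      then have "(cmod (D \<omega>))\<^sup>2 \<le> 2 * (cmod (?U \<omega>))\<^sup>2 + 2 * (cmod (\<Sum>n\<in>R. \<phi> n * ?V n \<omega>))\<^sup>2"
        by (simp only: norm_diff_square_le)
      also have "\<dots> \<le> 2 * (cmod (?U \<omega>))\<^sup>2 + 2 * (real (card R) * (\<Sum>n\<in>R. (cmod (\<phi> n * ?V n \<omega>))\<^sup>2))"
        by (intro add_left_mono mult_left_mono norm_sum_square_le) simp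
      also have "\<dots> = 2 * (cmod (?U \<omega>))\<^sup>2 + (\<Sum>n\<in>R. 2 * real (card R) * (cmod (\<phi> n))\<^sup>2 * (cmod (?V n \<omega>))\<^sup>2)"
        by (simp add: norm_mult power_mult_distrib sum_distrib_left mult_ac)
      finally have "ennreal ((cmod (D \<omega>))\<^sup>2) \<le> ennreal (2 * (cmod (?U \<omega>))\<^sup>2 + (\<Sum>n\<in>R. 2 * real (card R) * (cmod (\<phi> n))\<^sup>2 * (cmod (?V n \<omega>))\<^sup>2))"
        by (rule ennreal_leI)
      also have "\<dots> = ennreal (2 * (cmod (?U \<omega>))\<^sup>2) + (\<Sum>n\<in>R. ennreal (2 * real (card R) * (cmod (\<phi> n))\<^sup>2 * (cmod (?V n \<omega>))\<^sup>2))"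
        by (subst ennreal_plus, simp, simp add: sum_nonneg, subst sum_ennreal, simp, rule refl)
      also have "\<dots> = 2 * ennreal ((cmod (?U \<omega>))\<^sup>2) + (\<Sum>n\<in>R. ennreal (2 * real (card R) * (cmod (\<phi> n))\<^sup>2) * ennreal ((cmod (?V n \<omega>))\<^sup>2))"
        by (simp only: m ennreal_numeral)
      finally show "ennreal ((cmod (D \<omega>))\<^sup>2) \<le> \<dots>" .
    qed
    also have "\<dots> = ?bound A"
      by (simp add: nn_integral_add nn_integral_sum nn_integral_cmult L2_err_def T_def)
    finally show ?thesis .
  qed
  \<comment> \<open>The shifted sets are cofinal too: \<open>sh n A\<close> contains
    \<open>X\<close> as soon as \<open>A\<close> contains \<open>X\<close> translated by
    \<open>n\<close>.\<close>
  have sh: "filterlim (sh n) (finite_subsets_at_top UNIV) (finite_subsets_at_top UNIV)" for n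
    unfolding filterlim_finite_subsets_at_top
  proof (intro allI impI)
    fix X :: "(nat ^ 'd) set" assume X: "finite X \<and> X \<subseteq> UNIV"
    show "eventually (\<lambda>A. finite (sh n A) \<and> X \<subseteq> sh n A \<and> sh n A \<subseteq> UNIV) (finite_subsets_at_top UNIV)"
      unfolding eventually_finite_subsets_at_top
      using X fin_sh by (intro exI[of _ "(\<lambda>j. j + n) ` X"]) (auto simp: sh_def)
  qed
  have "(?bound \<longlongrightarrow> 2 * 0 + (\<Sum>n\<in>R. ennreal (2 * real (card R) * (cmod (\<phi> n))\<^sup>2) * 0)) (finite_subsets_at_top UNIV)"
    by (intro tendsto_add tendsto_sum ennreal_tendsto_cmult lim filterlim_compose[OF lim sh]) auto
  then have b0: "(?bound \<longlongrightarrow> 0) (finite_subsets_at_top UNIV)" by simp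
  have "(\<integral>\<^sup>+\<omega>. ennreal ((cmod (D \<omega>))\<^sup>2) \<partial>M) \<le> 0"
  proof (rule tendsto_lowerbound[OF b0])
    show "eventually (\<lambda>A. (\<integral>\<^sup>+\<omega>. ennreal ((cmod (D \<omega>))\<^sup>2) \<partial>M) \<le> ?bound A) (finite_subsets_at_top UNIV)"
      unfolding eventually_finite_subsets_at_top
      by (rule exI[of _ "insert 0 S"]) (use S le in auto)
  qed simp
  then have "AE \<omega> in M. ennreal ((cmod (D \<omega>))\<^sup>2) = 0"
    by (subst nn_integral_0_iff_AE[symmetric]) auto
  then show ?thesis by eventually_elim (simp add: D_def)
qed

lemma causal_solution_L2:
  fixes \<phi> \<theta> :: "nat ^ 'd \<Rightarrow> complex"
  assumes R: "finite R" "0 \<notin> R" and S: "finite S" "0 \<notin> S"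
  defines "\<psi> \<equiv> arma_coeff R \<phi> S \<theta>"
  assumes sum: "(\<lambda>k. (cmod (\<psi> k))\<^sup>2) summable_on UNIV"
  shows "\<exists>Y. causal_solution M R \<phi> S \<theta> Z Y \<and> linear_field_L2 M \<psi> Z Y"
proof -
  have "\<exists>N. \<forall>B. finite B \<and> B \<inter> {k. mdeg k \<le> N} = {} \<longrightarrow> (\<Sum>k\<in>B. (cmod (\<psi> k))\<^sup>2) \<le> (1 / 4) ^ j" for j
  proof -
    obtain A where A: "finite A" "\<And>B. finite B \<Longrightarrow> B \<inter> A = {} \<Longrightarrow> (\<Sum>k\<in>B. (cmod (\<psi> k))\<^sup>2) \<le> (1 / 4) ^ j"
      using summable_tail_small[OF sum, of "(1 / 4) ^ j"] by auto
    have "A \<subseteq> {k. mdeg k \<le> Max (mdeg ` A)}" using A(1) by auto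
    with A(2) show ?thesis by (intro exI[of _ "Max (mdeg ` A)"]) blast
  qed
  then obtain N where N: "\<And>j B. finite B \<Longrightarrow> B \<inter> {k. mdeg k \<le> N j} = {} \<Longrightarrow> (\<Sum>k\<in>B. (cmod (\<psi> k))\<^sup>2) \<le> (1 / 4) ^ j"
    by metis
  \<comment> \<open>Accumulating the \<open>N i\<close> makes the index sets increasing and keeps
    the tail bound at stage \<open>j\<close>; the added \<open>j\<close> makes them exhaust all
    multi-indices.\<close>
  define n where "n j = (\<Sum>i\<le>j. N i) + j" for j
  define G where "G j = {k :: nat ^ 'd. mdeg k \<le> n j}" for j
  have "filterlim n at_top sequentially"
    by (rule filterlim_at_top_mono[OF filterlim_ident]) (simp add: n_def)
  from filterlim_compose[OF filterlim_mdeg_le this]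
  have G: "filterlim G (finite_subsets_at_top UNIV) sequentially" unfolding G_def .
  have small: "(\<Sum>k\<in>B. (cmod (\<psi> k))\<^sup>2) \<le> (1 / 4) ^ j" if B: "finite B" "B \<inter> G j = {}" for j B
  proof (rule N[OF B(1)])
    have "N j \<le> n j" unfolding n_def using member_le_sum[of j "{..j}" N] by simp
    then show "B \<inter> {k. mdeg k \<le> N j} = {}" using B(2) by (auto simp: G_def)
  qed
  define Y where "Y = lim_field G \<psi> Z"
  have "AE \<omega> in M. (\<lambda>j. \<Sum>k\<in>G j. \<psi> k * Z (lag t k) \<omega>) \<longlonglongrightarrow> Y t \<omega>" for t
    unfolding Y_def by (rule AE_partial_sums_tendsto) (auto simp: G_def finite_mdeg_le n_def intro: small[unfolded G_def n_def])
  from L2_err_tendsto[OF sum G this]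
  have lim: "(L2_err \<psi> Y t \<longlongrightarrow> 0) (finite_subsets_at_top UNIV)" for t .
  have mY: "Y t \<in> borel_measurable M" for t unfolding Y_def by (rule lim_field_measurable)
  have "causal_solution M R \<phi> S \<theta> Z Y"
    unfolding causal_solution_def arma_equation_def
    using lim_field_stationary lim_field_measurable_past arma_of_L2[OF R S mY lim[unfolded \<psi>_def]]
    by (auto simp: Y_def)
  moreover have "linear_field_L2 M \<psi> Z Y"
    unfolding linear_field_L2_def L2_err_def[symmetric] using lim by simp
  ultimately show ?thesis by blast
qed

end

section \<open>Each moment condition joined with the matching bound on the coefficients\<close>

theorem theorem3p9:
  fixes M :: "'w measure"
    and R S :: "(nat ^ 'd::finite) set"
    and \<phi> \<theta> :: "nat ^ 'd \<Rightarrow> complex"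
    and Z :: "int ^ 'd \<Rightarrow> 'w \<Rightarrow> complex"
  assumes "prob_space M"
    and "finite R" and "0 \<notin> R"
    and "finite S" and "0 \<notin> S"
    and "iid_field M Z"
  shows "(integrable M (\<lambda>\<omega>. log_plus (cmod (Z 0 \<omega>)) ^ CARD('d)) \<and>
          (\<forall>z \<in> closure polydisc. ar_poly R \<phi> z \<noteq> 0) \<longrightarrow>
            (\<exists>\<psi> Y. (\<forall>z \<in> polydisc. ((\<lambda>k. \<psi> k * monomial z k) has_sum
                        ma_poly S \<theta> z / ar_poly R \<phi> z) UNIV) \<and>
                   causal_solution M R \<phi> S \<theta> Z Y \<and>
                   linear_field_as M \<psi> Z Y))
       \<and> (\<forall>f. integrable M (\<lambda>\<omega>. (cmod (Z 0 \<omega>))\<^sup>2) \<and> (LINT \<omega>|M. Z 0 \<omega>) = 0 \<and>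
          f \<in> hardy2 \<and> (\<forall>z \<in> polydisc. ar_poly R \<phi> z * f z = ma_poly S \<theta> z) \<longrightarrow>
            (\<exists>\<psi> Y. (\<forall>z \<in> polydisc. ((\<lambda>k. \<psi> k * monomial z k) has_sum f z) UNIV) \<and>
                   causal_solution M R \<phi> S \<theta> Z Y \<and>
                   linear_field_L2 M \<psi> Z Y))"
proof (intro conjI allI impI)
  interpret iid_random_field M Z
    by (intro iid_random_field.intro iid_random_field_axioms.intro assms)
  note R = assms(2,3) and S = assms(4,5)
  \<comment> \<open>The formal quotient is the witness in both cases; only the bound on its
    coefficients differs.\<close>
  define \<psi> where "\<psi> = arma_coeff R \<phi> S \<theta>"
  {
    assume *: "integrable M (\<lambda>\<omega>. log_plus (cmod (Z 0 \<omega>)) ^ CARD('d)) \<and>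
      (\<forall>z \<in> closure polydisc. ar_poly R \<phi> z \<noteq> 0)"
    obtain \<rho> C where \<rho>: "\<rho> > 1" and C: "\<And>k. cmod (\<psi> k) * \<rho> ^ mdeg k \<le> C"
      and sum: "\<And>z. z \<in> polydisc \<Longrightarrow> ((\<lambda>k. \<psi> k * monomial z k) has_sum ma_poly S \<theta> z / ar_poly R \<phi> z) UNIV"
      by (rule coeff_decay_of_nonvanishing[where \<theta> = \<theta>, OF R S(1) conjunct2[OF *], folded \<psi>_def])
        (rule that)
    have "\<exists>Y. causal_solution M R \<phi> S \<theta> Z Y \<and> linear_field_as M \<psi> Z Y"
      unfolding \<psi>_def by (rule causal_solution_as[OF R S conjunct1[OF *] \<rho> C[unfolded \<psi>_def]])
    with sum show "\<exists>\<psi> Y. (\<forall>z \<in> polydisc. ((\<lambda>k. \<psi> k * monomial z k) has_sum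
        ma_poly S \<theta> z / ar_poly R \<phi> z) UNIV) \<and> causal_solution M R \<phi> S \<theta> Z Y \<and> linear_field_as M \<psi> Z Y"
      by blast
  next
    fix f
    assume *: "integrable M (\<lambda>\<omega>. (cmod (Z 0 \<omega>))\<^sup>2) \<and> (LINT \<omega>|M. Z 0 \<omega>) = 0 \<and>
      f \<in> hardy2 \<and> (\<forall>z \<in> polydisc. ar_poly R \<phi> z * f z = ma_poly S \<theta> z)"
    interpret centred_iid_random_field M Z
      by unfold_locales (use * in auto)
    have f: "f \<in> hardy2" "\<forall>z \<in> polydisc. ar_poly R \<phi> z * f z = ma_poly S \<theta> z" using * by auto
    have "\<forall>z \<in> polydisc. ((\<lambda>k. \<psi> k * monomial z k) has_sum f z) UNIV"
      unfolding \<psi>_def using coeff_square_summable_of_hardy2(1)[OF R S(1) f] by blast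
    moreover have "\<exists>Y. causal_solution M R \<phi> S \<theta> Z Y \<and> linear_field_L2 M \<psi> Z Y"
      unfolding \<psi>_def by (rule causal_solution_L2[OF R S coeff_square_summable_of_hardy2(2)[OF R S(1) f]])
    ultimately show "\<exists>\<psi> Y. (\<forall>z \<in> polydisc. ((\<lambda>k. \<psi> k * monomial z k) has_sum f z) UNIV) \<and>
        causal_solution M R \<phi> S \<theta> Z Y \<and> linear_field_L2 M \<psi> Z Y"
      by blast
  }
qed

end
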